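(* Let $\Bbbk=\mathbb{R}$. Assume that the equation $x'=A_3(t)x^{n_3}+A_2(t)x^{n_2}+A_1(t)x^{n_1}$ satisfies (ND) and has at least two nonconstant rational solutions (in $\mathbb{R}(t)$). Let $r:=\max\Gamma_{\mathrm{sol}}$ be the maximal realized denominator degree, and let $\mathcal{S}$ be the total number of nonconstant rational solutions. Then: (a) If (C1) holds, then necessarily $T_r=\{3,2,\partial\}$ and $\mathcal{S}\le4$. (b) If (C2) holds and $T_r=\{2,1\}$, then $\mathcal{S}\le5$. (c) If (C2) holds and $T_r=\{3,2,1\}$, then $\mathcal{S}\le4$. (d) If (C3) holds and $T_r=\{2,1,\partial\}$, then $\mathcal{S}\le12$. (e) If (C3) holds and $T_r=\{3,1,\partial\}$, then $\mathcal{S}\le4$. (f) If (C3) holds and $T_r=\{3,2,1,\partial\}$, then $\mathcal{S}\le5$. Here (C1): $a_1<(n_1-1)r-1$ and $a_2=(n_2-1)r-1$; (C2): $a_1>(n_1-1)r-1$ and $a_2=a_1+(n_2-n_1)r$; (C3): $a_1=(n_1-1)r-1$ and $a_2\le(n_2-1)r-1$.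
   Context: Setting. $n_1,n_2,n_3$ are natural numbers with $1<n_1<n_2<n_3$; $A_1,A_2,A_3\in\mathbb{R}[t]$ are nonzero, $a_i:=\deg A_i$, and $\alpha_i\in\mathbb{R}^\times$ is the leading coefficient of $A_i$. Every nonconstant rational solution of the equation has the form $x=1/p(t)$ with $p\in\mathbb{R}[t]$, $\deg p\ge1$; $\Gamma_{\mathrm{sol}}$ denotes the set of all $\deg p$ such that $1/p$ is a nonconstant rational solution of the equation. Tie sets and edge polynomials. The symbol $\partial$ is an extra index (encoding the derivative term), with $a_\partial=-1$, $n_\partial=1$. For $r\in\mathbb{N}_{>0}$ set $\Phi_i(r)=n_ir-a_i$ ($i=1,2,3$), $\Phi_\partial(r)=r+1$, $O_r=\min\{\Phi_\ell(r):\ell\in\{3,2,1,\partial\}\}$ and $T_r=\{\ell\in\{3,2,1,\partial\}:\Phi_\ell(r)=O_r\}$. The value $r$ is edge-admissible if $|T_r|\ge2$; then its edge polynomial is $P_r(C)=\sum_{\ell\in T_r\cap\{3,2,1\}}\alpha_\ell C^{n_\ell}+\mathbf{1}_{\{\partial\in T_r\}}\,rC$. Candidate degrees. $r_{32}=\frac{a_3-a_2}{n_3-n_2}$, $r_{31}=\frac{a_3-a_1}{n_3-n_1}$, $r_{21}=\frac{a_2-a_1}{n_2-n_1}$, $r_{i\partial}=\frac{a_i+1}{n_i-1}$ ($i=1,2,3$), $r_0=\frac{a_3}{n_3-n_2}$, and $\Gamma=\{r_{32},r_{31},r_{21},r_{3\partial},r_{2\partial},r_{1\partial}\}\cap\mathbb{N}\cap(0,r_0]$.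 Hypothesis (ND) over $\mathbb{R}$. For every edge-admissible $r\in\Gamma$, with $e_r$ the multiplicity of $0$ as a root of $P_r$ and $\widetilde P_r(C)=P_r(C)/C^{e_r}$: (ND1) $\operatorname{Res}_C(\widetilde P_r(C),\widetilde P_r'(C))\ne0$, i.e. $\widetilde P_r$ has only simple roots; (ND2) if $\partial\in T_r$, then $P_r'(C)\notin\mathbb{Z}_{<0}$ for every nonzero root $C\in\mathbb{R}$ of $P_r$; (ND3,b) $\operatorname{Res}_C(\widetilde P_r(C),\widetilde P_r(-C))\ne0$ whenever at least one of $n_3-n_2$, $n_3-n_1$, $n_3-1$ is even (no condition if all three are odd). *)

theory Defs
  imports
    Complex_Main
    "HOL-Computational_Algebra.Polynomial"
    "HOL-Computational_Algebra.Fraction_Field"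
    "Subresultants.Resultant_Prelim"
begin

text \<open>The field of rational functions over the reals is \<^typ>\<open>real poly fract\<close>; its derivation
  is given by the quotient rule, which does not depend on the representation as a fraction.\<close>

definition rat_deriv :: "real poly fract \<Rightarrow> real poly fract" where
  "rat_deriv x = (THE y. \<exists>u v. v \<noteq> 0 \<and> x = Fract u v \<and>
     y = Fract (pderiv u * v - u * pderiv v) (v * v))"

lemma quotient_rule_welldefined:
  fixes u v w z :: "real poly"
  assumes v: "v \<noteq> 0" and z: "z \<noteq> 0" and eq: "Fract u v = Fract w z"
  shows "Fract (pderiv u * v - u * pderiv v) (v * v) = Fract (pderiv w * z - w * pderiv z) (z * z)"
proof -
  from eq have e: "u * z = w * v" unfolding eq_fract(1)[OF v z] .
  have d: "pderiv u * z + u * pderiv z = pderiv w * v + w * pderiv v"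
    using arg_cong[OF e, of pderiv] by (simp add: pderiv_mult algebra_simps)
  have "(pderiv u * v - u * pderiv v) * (z * z)
      = v * z * (pderiv u * z + u * pderiv z) - u * z * (v * pderiv z) - (u * z) * z * pderiv v"
    by (simp add: algebra_simps)
  also have "\<dots> = v * z * (pderiv w * v + w * pderiv v) - w * v * (v * pderiv z) - (w * v) * z * pderiv v"
    by (simp only: d e)
  also have "\<dots> = (pderiv w * z - w * pderiv z) * (v * v)"
    by (simp add: algebra_simps)
  finally show ?thesis using v z by (simp only: eq_fract(1) mult_eq_0_iff simp_thms not_False_eq_True)
qed

lemma rat_deriv_Fract:
  assumes "v \<noteq> 0"
  shows "rat_deriv (Fract u v) = Fract (pderiv u * v - u * pderiv v) (v * v)"
  unfolding rat_deriv_def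
proof (rule the_equality)
  show "\<exists>u' v'. v' \<noteq> 0 \<and> Fract u v = Fract u' v' \<and>
      Fract (pderiv u * v - u * pderiv v) (v * v) = Fract (pderiv u' * v' - u' * pderiv v') (v' * v')"
    using assms by (intro exI[of _ u] exI[of _ v]) (rule conjI, assumption, rule conjI, rule refl, rule refl)
next
  fix y
  assume "\<exists>u' v'. v' \<noteq> 0 \<and> Fract u v = Fract u' v' \<and>
      y = Fract (pderiv u' * v' - u' * pderiv v') (v' * v')"
  then obtain u' v' where "v' \<noteq> 0" "Fract u v = Fract u' v'"
      "y = Fract (pderiv u' * v' - u' * pderiv v') (v' * v')" by (elim exE conjE)
  thus "y = Fract (pderiv u * v - u * pderiv v) (v * v)"
    by (metis assms quotient_rule_welldefined)
qed

text \<open>Exponents and coefficients are given by functions \<open>n\<close> and \<open>A\<close> on the naturals, of which only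
  the values at 1, 2, 3 matter.\<close>

definition nonconst_rat_sols :: "(nat \<Rightarrow> nat) \<Rightarrow> (nat \<Rightarrow> real poly) \<Rightarrow> real poly fract set" where
  "nonconst_rat_sols n A =
    {x. x \<notin> range (\<lambda>c. Fract [:c:] 1) \<and>
        rat_deriv x = Fract (A 3) 1 * x ^ n 3 + Fract (A 2) 1 * x ^ n 2 + Fract (A 1) 1 * x ^ n 1}"

definition Gamma_sol :: "(nat \<Rightarrow> nat) \<Rightarrow> (nat \<Rightarrow> real poly) \<Rightarrow> nat set" where
  "Gamma_sol n A = {degree p |p. degree p \<ge> 1 \<and> Fract 1 p \<in> nonconst_rat_sols n A}"

text \<open>\<open>Deriv\<close> is the extra index for the derivative term.\<close>

datatype tie_index = Term nat | Deriv

fun \<Phi> :: "(nat \<Rightarrow> nat) \<Rightarrow> (nat \<Rightarrow> real poly) \<Rightarrow> nat \<Rightarrow> tie_index \<Rightarrow> int" where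
  "\<Phi> n A r (Term i) = int (n i) * int r - int (degree (A i))"
| "\<Phi> n A r Deriv = int r + 1"

definition tie_indices :: "tie_index set" where
  "tie_indices = {Term 3, Term 2, Term 1, Deriv}"

definition min_order :: "(nat \<Rightarrow> nat) \<Rightarrow> (nat \<Rightarrow> real poly) \<Rightarrow> nat \<Rightarrow> int" where
  "min_order n A r = Min (\<Phi> n A r ` tie_indices)"

definition tie_set :: "(nat \<Rightarrow> nat) \<Rightarrow> (nat \<Rightarrow> real poly) \<Rightarrow> nat \<Rightarrow> tie_index set" where
  "tie_set n A r = {l \<in> tie_indices. \<Phi> n A r l = min_order n A r}"

definition edge_admissible :: "(nat \<Rightarrow> nat) \<Rightarrow> (nat \<Rightarrow> real poly) \<Rightarrow> nat \<Rightarrow> bool" where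
  "edge_admissible n A r \<longleftrightarrow> r > 0 \<and> card (tie_set n A r) \<ge> 2"

definition edge_poly :: "(nat \<Rightarrow> nat) \<Rightarrow> (nat \<Rightarrow> real poly) \<Rightarrow> nat \<Rightarrow> real poly" where
  "edge_poly n A r =
     (\<Sum>i | i \<in> {1, 2, 3} \<and> Term i \<in> tie_set n A r. monom (lead_coeff (A i)) (n i))
     + (if Deriv \<in> tie_set n A r then monom (real r) 1 else 0)"

definition reduced_edge_poly :: "(nat \<Rightarrow> nat) \<Rightarrow> (nat \<Rightarrow> real poly) \<Rightarrow> nat \<Rightarrow> real poly" where
  "reduced_edge_poly n A r = edge_poly n A r div monom 1 (order 0 (edge_poly n A r))"

definition cand_pair :: "(nat \<Rightarrow> nat) \<Rightarrow> (nat \<Rightarrow> real poly) \<Rightarrow> nat \<Rightarrow> nat \<Rightarrow> real" where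
  "cand_pair n A i j = (real (degree (A i)) - real (degree (A j))) / (real (n i) - real (n j))"

definition cand_deriv :: "(nat \<Rightarrow> nat) \<Rightarrow> (nat \<Rightarrow> real poly) \<Rightarrow> nat \<Rightarrow> real" where
  "cand_deriv n A i = (real (degree (A i)) + 1) / (real (n i) - 1)"

definition cand_bound :: "(nat \<Rightarrow> nat) \<Rightarrow> (nat \<Rightarrow> real poly) \<Rightarrow> real" where
  "cand_bound n A = real (degree (A 3)) / (real (n 3) - real (n 2))"

definition Gamma_cand :: "(nat \<Rightarrow> nat) \<Rightarrow> (nat \<Rightarrow> real poly) \<Rightarrow> nat set" where
  "Gamma_cand n A =
    {r. real r \<in> {cand_pair n A 3 2, cand_pair n A 3 1, cand_pair n A 2 1,
                  cand_deriv n A 3, cand_deriv n A 2, cand_deriv n A 1}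
        \<and> real r \<in> {0<..cand_bound n A}}"

definition ND1 :: "(nat \<Rightarrow> nat) \<Rightarrow> (nat \<Rightarrow> real poly) \<Rightarrow> nat \<Rightarrow> bool" where
  "ND1 n A r \<longleftrightarrow> resultant (reduced_edge_poly n A r) (pderiv (reduced_edge_poly n A r)) \<noteq> 0"

definition ND2 :: "(nat \<Rightarrow> nat) \<Rightarrow> (nat \<Rightarrow> real poly) \<Rightarrow> nat \<Rightarrow> bool" where
  "ND2 n A r \<longleftrightarrow>
     (Deriv \<in> tie_set n A r \<longrightarrow>
       (\<forall>c::real. c \<noteq> 0 \<and> poly (edge_poly n A r) c = 0 \<longrightarrow>
          poly (pderiv (edge_poly n A r)) c \<notin> real_of_int ` {k. k < 0}))"

definition ND3b :: "(nat \<Rightarrow> nat) \<Rightarrow> (nat \<Rightarrow> real poly) \<Rightarrow> nat \<Rightarrow> bool" where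
  "ND3b n A r \<longleftrightarrow>
     (even (n 3 - n 2) \<or> even (n 3 - n 1) \<or> even (n 3 - 1) \<longrightarrow>
       resultant (reduced_edge_poly n A r) (pcompose (reduced_edge_poly n A r) [:0, -1:]) \<noteq> 0)"

definition ND :: "(nat \<Rightarrow> nat) \<Rightarrow> (nat \<Rightarrow> real poly) \<Rightarrow> bool" where
  "ND n A \<longleftrightarrow>
     (\<forall>r \<in> Gamma_cand n A. edge_admissible n A r \<longrightarrow> ND1 n A r \<and> ND2 n A r \<and> ND3b n A r)"

definition C1 :: "(nat \<Rightarrow> nat) \<Rightarrow> (nat \<Rightarrow> real poly) \<Rightarrow> nat \<Rightarrow> bool" where
  "C1 n A r \<longleftrightarrow>
     int (degree (A 1)) < (int (n 1) - 1) * int r - 1 \<and>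
     int (degree (A 2)) = (int (n 2) - 1) * int r - 1"

definition C2 :: "(nat \<Rightarrow> nat) \<Rightarrow> (nat \<Rightarrow> real poly) \<Rightarrow> nat \<Rightarrow> bool" where
  "C2 n A r \<longleftrightarrow>
     int (degree (A 1)) > (int (n 1) - 1) * int r - 1 \<and>
     int (degree (A 2)) = int (degree (A 1)) + (int (n 2) - int (n 1)) * int r"

definition C3 :: "(nat \<Rightarrow> nat) \<Rightarrow> (nat \<Rightarrow> real poly) \<Rightarrow> nat \<Rightarrow> bool" where
  "C3 n A r \<longleftrightarrow>
     int (degree (A 1)) = (int (n 1) - 1) * int r - 1 \<and>
     int (degree (A 2)) \<le> (int (n 2) - 1) * int r - 1"

end

theory Submission
  imports Defs "HOL-Computational_Algebra.Field_as_Ring" "Subresultants.Subresultant_Gcd"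
    "Subresultants.Dichotomous_Lazard"
begin

text \<open>A nonconstant rational solution is a reciprocal \<open>1 / p\<close>, and cancellation of the leading terms
  of the resulting polynomial equation makes the inverse leading coefficient of \<open>p\<close> a root of the
  edge polynomial of \<open>r = degree p\<close>. If two solutions had the same degree and leading coefficient,
  linearizing around one of them would give \<open>P\<^sub>r' = s - r\<close> at that root, where \<open>s < r\<close> is the degree
  of the difference of the denominators (or \<open>P\<^sub>r' = 0\<close> if the derivative is not tied), against (ND).
  So there are at most as many solutions as nonzero real roots of edge polynomials of realized
  degrees. The orders \<open>\<Phi>\<close> are affine in the degree with slopes \<open>n 3 > n 2 > n 1 > 1\<close>, so below the
  maximal realized degree the only possible tie is between the terms 3 and 2, and there is none if
  the term 3 is tied at the maximal degree. Finally, Rolle's theorem bounds the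
  number of nonzero real roots of a polynomial with \<open>k\<close> terms by \<open>2 * (k - 1)\<close>, with one root
  less for every odd gap between consecutive exponents. A tie of one term with the derivative is
  excluded by (ND2), as there \<open>P\<^sub>r' = - (n i - 1) * r\<close> at the nonzero roots.\<close>

subsection \<open>Nonzero real roots of sparse polynomials\<close>

text \<open>Counting the points of \<open>Z\<close> below \<open>x\<close> gives a strictly
  increasing function on \<open>S\<close> with values in \<open>{..card Z}\<close>.\<close>

lemma card_le_separated:
  fixes S Z :: "'a :: linorder set"
  assumes fin: "finite Z"
    and sep: "\<And>x y. x \<in> S \<Longrightarrow> y \<in> S \<Longrightarrow> x < y \<Longrightarrow> \<exists>z\<in>Z. x < z \<and> z < y"
  shows "card S \<le> card Z + 1"
proof -
  define f where "f x = card {z \<in> Z. z < x}" for x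
  have less: "f x < f y" if xy: "x \<in> S" "y \<in> S" "x < y" for x y
  proof -
    obtain z where "z \<in> Z" "x < z" "z < y" using sep xy by blast
    then have "z \<in> {z \<in> Z. z < y} - {z \<in> Z. z < x}" by auto
    moreover have "{z \<in> Z. z < x} \<subseteq> {z \<in> Z. z < y}" using xy by auto
    ultimately have "{z \<in> Z. z < x} \<subset> {z \<in> Z. z < y}" by blast
    then show ?thesis unfolding f_def using fin by (intro psubset_card_mono) auto
  qed
  have "inj_on f S"
    by (rule inj_onI) (metis less less_irrefl linorder_neqE)
  moreover have "f ` S \<subseteq> {..card Z}"
    unfolding f_def using fin by (auto intro: card_mono)
  ultimately have "card S \<le> card {..card Z}" by (intro card_inj_on_le) auto
  then show ?thesis by simp
qed

definition nz_roots :: "real poly \<Rightarrow> real set" where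
  "nz_roots p = {x. x \<noteq> 0 \<and> poly p x = 0}"

lemma finite_nz_roots: "p \<noteq> 0 \<Longrightarrow> finite (nz_roots p)"
  unfolding nz_roots_def by (rule finite_subset[OF _ poly_roots_finite[of p]]) auto

lemma nz_roots_monom_mult [simp]: "c \<noteq> 0 \<Longrightarrow> nz_roots (monom c k * p) = nz_roots p"
  by (auto simp: nz_roots_def poly_monom)

lemma nz_roots_monom [simp]: "c \<noteq> 0 \<Longrightarrow> nz_roots (monom c k) = {}"
  by (auto simp: nz_roots_def poly_monom)

text \<open>The cost of one Rolle step when the derivative vanishes to order \<open>e - 1\<close> at
  0: one for Rolle itself, and one more for 0 as an additional separating critical point unless
  \<open>e\<close> is odd.\<close>

definition gap_weight :: "nat \<Rightarrow> nat" where
  "gap_weight e = (if odd e then 1 else 2)"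

text \<open>If the derivative vanishes to even order at 0, it does not change sign there, so Rolle's theorem
  still gives a nonzero critical point between a negative and a positive root.\<close>

lemma card_nz_roots_Rolle:
  assumes p': "pderiv p = monom 1 (e - 1) * g" and e: "0 < e" and g0: "poly g 0 \<noteq> 0"
  shows "card (nz_roots p) \<le> card (nz_roots g) + gap_weight e"
proof -
  from g0 have fin: "finite (nz_roots g)" by (intro finite_nz_roots) auto
  have deriv: "poly (pderiv p) z = z ^ (e - 1) * poly g z" for z
    by (simp add: p' poly_monom)
  have rolle: "\<exists>z. x < z \<and> z < y \<and> z ^ (e - 1) * poly g z = 0"
    if "x \<in> nz_roots p" "y \<in> nz_roots p" "x < y" for x y
    using poly_MVT[of x y p] that by (auto simp: nz_roots_def deriv)
  show ?thesis
  proof (cases "odd e")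
    case False
    have "\<exists>z\<in>insert 0 (nz_roots g). x < z \<and> z < y"
      if "x \<in> nz_roots p" "y \<in> nz_roots p" "x < y" for x y
      using rolle[OF that] by (auto simp: nz_roots_def)
    then have "card (nz_roots p) \<le> card (insert 0 (nz_roots g)) + 1"
      using fin by (intro card_le_separated) auto
    also have "card (insert 0 (nz_roots g)) \<le> card (nz_roots g) + 1"
      using fin by (simp add: card_insert_if)
    finally show ?thesis using False by (simp add: gap_weight_def)
  next
    case True
    have "\<exists>z\<in>nz_roots g. x < z \<and> z < y"
      if xy: "x \<in> nz_roots p" "y \<in> nz_roots p" "x < y" for x y
    proof (cases "x < 0 \<and> 0 < y")
      case False
      then have "z \<noteq> 0" if "x < z" "z < y" for z using that by auto
      with rolle[OF xy] show ?thesis by (auto simp: nz_roots_def)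
    next
      case True
      obtain u where u: "x < u" "u < 0" "poly p 0 - poly p x = (0 - x) * poly (pderiv p) u"
        using poly_MVT[of x 0 p] True by auto
      obtain v where v: "0 < v" "v < y" "poly p y - poly p 0 = (y - 0) * poly (pderiv p) v"
        using poly_MVT[of 0 y p] True by auto
      \<comment> \<open>Adding the two mean value identities eliminates \<open>poly p 0\<close>.
        Both weights are positive because \<open>e - 1\<close> is even, so \<open>g\<close> has
        opposite signs at \<open>u\<close> and \<open>v\<close> or vanishes at both.\<close>
      have eq: "(-x * u ^ (e - 1)) * poly g u + (y * v ^ (e - 1)) * poly g v = 0"
        using u(3) v(3) xy by (simp add: nz_roots_def deriv algebra_simps)
      have pos: "-x * u ^ (e - 1) > 0" "y * v ^ (e - 1) > 0"
        using True u v \<open>odd e\<close> by (auto simp: mult_less_0_iff zero_less_power_eq)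
      have "\<exists>z. u \<le> z \<and> z \<le> v \<and> poly g z = 0"
      proof (cases "poly g u = 0")
        case False
        define a b where "a = -x * u ^ (e - 1)" and "b = y * v ^ (e - 1)"
        have "a * poly g u + b * poly g v = 0" "a > 0" "b > 0"
          using eq pos by (simp_all add: a_def b_def)
        then have bg: "b * poly g v = - (a * poly g u)" by linarith
        have "b * (poly g u * poly g v) = poly g u * (b * poly g v)" by (simp only: ac_simps)
        also have "\<dots> = - (a * (poly g u * poly g u))"
          unfolding bg by (simp only: mult_minus_right ac_simps)
        also have "\<dots> < 0" using \<open>a > 0\<close> False
          by (auto simp: zero_less_mult_iff not_less_iff_gr_or_eq)
        finally have "poly g u * poly g v < 0"
          using \<open>b > 0\<close> by (meson mult_less_0_iff not_less_iff_gr_or_eq)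
        then show ?thesis using poly_IVT[of u v g] u v by (meson less_imp_le less_trans)
      qed (use u v in \<open>intro exI[of _ u], auto\<close>)
      then obtain z where "u \<le> z" "z \<le> v" "poly g z = 0" by blast
      moreover from this g0 have "z \<noteq> 0" by auto
      ultimately show ?thesis using u v by (intro bexI[of _ z]) (auto simp: nz_roots_def)
    qed
    then have "card (nz_roots p) \<le> card (nz_roots g) + 1"
      using fin by (intro card_le_separated) auto
    then show ?thesis using True by (simp add: gap_weight_def)
  qed
qed

text \<open>After division by \<open>monom 1 a\<close> the derivative is a single monomial, so the
  Rolle step starts from a nonzero constant cofactor.\<close>

lemma card_nz_roots_binomial:
  assumes "a < b" "\<alpha> \<noteq> 0" "\<beta> \<noteq> (0 :: real)"
  shows "card (nz_roots (monom \<alpha> a + monom \<beta> b)) \<le> gap_weight (b - a)"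
proof -
  define p where "p = monom \<alpha> 0 + monom \<beta> (b - a)"
  have "monom \<alpha> a + monom \<beta> b = monom 1 a * p"
    using assms by (simp add: p_def distrib_left mult_monom)
  moreover have "pderiv p = monom 1 (b - a - 1) * [:real (b - a) * \<beta>:]"
    using assms by (simp add: p_def pderiv_add pderiv_monom smult_monom)
  moreover have "poly [:real (b - a) * \<beta>:] 0 \<noteq> 0" using assms by simp
  moreover have "nz_roots [:real (b - a) * \<beta>:] = {}"
    using assms by (simp add: nz_roots_def)
  ultimately show ?thesis
    using card_nz_roots_Rolle[of p "b - a" "[:real (b - a) * \<beta>:]"] assms by simp
qed

text \<open>After division by \<open>monom 1 a\<close>, differentiation removes the constant term.
  The cofactor \<open>q\<close> has one term fewer, a nonzero constant term and the remaining gap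
  \<open>c - b\<close>, so the binomial bound applies to it.\<close>

lemma card_nz_roots_trinomial:
  assumes "a < b" "b < c" "\<alpha> \<noteq> 0" "\<beta> \<noteq> 0" "\<gamma> \<noteq> (0 :: real)"
  shows "card (nz_roots (monom \<alpha> a + monom \<beta> b + monom \<gamma> c))
    \<le> gap_weight (b - a) + gap_weight (c - b)"
proof -
  define p where "p = monom \<alpha> 0 + monom \<beta> (b - a) + monom \<gamma> (c - a)"
  define q where "q = monom (real (b - a) * \<beta>) 0 + monom (real (c - a) * \<gamma>) (c - b)"
  have "monom \<alpha> a + monom \<beta> b + monom \<gamma> c = monom 1 a * p"
    using assms by (simp add: p_def distrib_left mult_monom)
  moreover have "pderiv p = monom 1 (b - a - 1) * q"
    using assms by (simp add: p_def q_def pderiv_add pderiv_monom distrib_left mult_monom)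
  moreover have "poly q 0 \<noteq> 0" using assms by (simp add: q_def poly_monom power_0_left)
  moreover have "card (nz_roots q) \<le> gap_weight (c - b)"
    unfolding q_def using card_nz_roots_binomial[of 0 "c - b"] assms by simp
  ultimately show ?thesis
    using card_nz_roots_Rolle[of p "b - a" q] assms by simp
qed

lemma card_nz_roots_quadrinomial:
  assumes "a < b" "b < c" "c < d" "\<alpha> \<noteq> 0" "\<beta> \<noteq> 0" "\<gamma> \<noteq> 0" "\<delta> \<noteq> (0 :: real)"
  shows "card (nz_roots (monom \<alpha> a + monom \<beta> b + monom \<gamma> c + monom \<delta> d))
    \<le> gap_weight (b - a) + gap_weight (c - b) + gap_weight (d - c)"
proof -
  define p where "p = monom \<alpha> 0 + monom \<beta> (b - a) + monom \<gamma> (c - a) + monom \<delta> (d - a)"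
  define q where "q = monom (real (b - a) * \<beta>) 0 + monom (real (c - a) * \<gamma>) (c - b)
    + monom (real (d - a) * \<delta>) (d - b)"
  have "monom \<alpha> a + monom \<beta> b + monom \<gamma> c + monom \<delta> d = monom 1 a * p"
    using assms by (simp add: p_def distrib_left mult_monom)
  moreover have "pderiv p = monom 1 (b - a - 1) * q"
    using assms by (simp add: p_def q_def pderiv_add pderiv_monom distrib_left mult_monom)
  moreover have "poly q 0 \<noteq> 0" using assms by (simp add: q_def poly_monom power_0_left)
  moreover have "card (nz_roots q) \<le> gap_weight (c - b) + gap_weight (d - c)"
    unfolding q_def using card_nz_roots_trinomial[of 0 "c - b" "d - b"] assms by simp
  ultimately show ?thesis
    using card_nz_roots_Rolle[of p "b - a" q] assms by simp
qed

subsection \<open>Leading coefficients and fractions\<close>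

text \<open>Degree bounds take the place of degrees so that a factor falling short of its bound
  contributes 0; tied and untied terms can then be treated alike.\<close>

lemma coeff_mult_at_degree_bounds:
  fixes p q :: "'a :: comm_semiring_0 poly"
  assumes "degree p \<le> a" "degree q \<le> b"
  shows "coeff (p * q) (a + b) = coeff p a * coeff q b"
proof -
  have "coeff p i * coeff q (a + b - i) = (if i = a then coeff p a * coeff q b else 0)"
    if "i \<le> a + b" for i
    using assms that by (cases i a rule: linorder_cases) (auto simp: coeff_eq_0)
  then have "coeff (p * q) (a + b) = (\<Sum>i\<le>a + b. if i = a then coeff p a * coeff q b else 0)"
    unfolding coeff_mult by (intro sum.cong) auto
  then show ?thesis by simp
qed

lemma degree_power_bound:
  fixes p :: "'a :: comm_semiring_1 poly"
  assumes "degree p \<le> r" shows "degree (p ^ k) \<le> k * r"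
  using degree_power_le[of p k] assms by (metis le_trans mult.commute mult_le_mono2)

lemma coeff_power_at_degree_bound:
  fixes p :: "'a :: comm_semiring_1 poly"
  assumes "degree p \<le> r"
  shows "coeff (p ^ k) (k * r) = coeff p r ^ k"
  by (induction k)
    (simp_all add: coeff_mult_at_degree_bounds[OF assms degree_power_bound[OF assms]])

text \<open>The difference of powers is \<open>p - q\<close> times a sum of \<open>Suc k\<close>
  products, each with coefficient \<open>coeff p r ^ k\<close> at \<open>k * r\<close>; every
  induction step contributes one product.\<close>

lemma power_diff_top:
  fixes p q :: "'a :: comm_ring_1 poly"
  assumes "degree p \<le> r" "degree q \<le> r" "coeff q r = coeff p r" "degree (p - q) \<le> s"
  shows "degree (p ^ Suc k - q ^ Suc k) \<le> k * r + s \<and>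
    coeff (p ^ Suc k - q ^ Suc k) (k * r + s) = of_nat (Suc k) * coeff p r ^ k * coeff (p - q) s"
proof (induction k)
  case 0
  then show ?case using assms by simp
next
  case (Suc k)
  have eq: "p ^ Suc (Suc k) - q ^ Suc (Suc k)
      = p ^ Suc k * (p - q) + q * (p ^ Suc k - q ^ Suc k)"
    by (simp add: algebra_simps)
  have deg: "degree (p ^ Suc k) \<le> Suc k * r" by (rule degree_power_bound) fact
  have "degree (p ^ Suc k * (p - q)) \<le> Suc k * r + s"
    using degree_mult_le[of "p ^ Suc k" "p - q"] deg assms(4) by linarith
  moreover have "degree (q * (p ^ Suc k - q ^ Suc k)) \<le> Suc k * r + s"
    using degree_mult_le[of q "p ^ Suc k - q ^ Suc k"] Suc.IH assms(2) by simp
  moreover have "coeff (p ^ Suc k * (p - q)) (Suc k * r + s)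
      = coeff p r ^ Suc k * coeff (p - q) s"
    using coeff_mult_at_degree_bounds[OF deg assms(4)] coeff_power_at_degree_bound[OF assms(1)]
    by metis
  moreover have "coeff (q * (p ^ Suc k - q ^ Suc k)) (Suc k * r + s)
      = coeff p r * (of_nat (Suc k) * coeff p r ^ k * coeff (p - q) s)"
    using coeff_mult_at_degree_bounds[OF assms(2), of "p ^ Suc k - q ^ Suc k" "k * r + s"] Suc.IH
      assms(3) by (simp add: add.assoc)
  ultimately show ?case
    unfolding eq coeff_add by (simp add: degree_add_le del: power_Suc) (simp add: algebra_simps)
qed

lemma Fract_one_mult_power:
  assumes "v \<noteq> 0" "k \<le> N"
  shows "Fract c 1 * Fract u v ^ k = Fract (c * u ^ k * v ^ (N - k)) (v ^ N)"
proof -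
  have "v ^ N = v ^ k * v ^ (N - k)" using power_add[of v k "N - k"] assms by simp
  then have eq: "c * u ^ k * v ^ N = (c * u ^ k * v ^ (N - k)) * (1 * v ^ k)"
    by (simp only: ac_simps mult_1_left)
  show ?thesis
    unfolding power_fract mult_fract
    by (rule eq_fract(1)[THEN iffD2, OF _ _ eq]) (use assms in auto)
qed

lemma Fract_add_same:
  assumes "d \<noteq> 0" shows "Fract a d + Fract b d = Fract (a + b) d"
proof -
  have eq: "(a * d + b * d) * d = (a + b) * (d * d)" by (simp add: algebra_simps)
  show ?thesis
    unfolding add_fract[OF assms assms]
    by (rule eq_fract(1)[THEN iffD2, OF _ _ eq]) (use assms in auto)
qed

section \<open>From rational solutions to polynomial denominators\<close>

locale three_term =
  fixes n :: "nat \<Rightarrow> nat" and A :: "nat \<Rightarrow> real poly"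
  assumes n: "1 < n 1" "n 1 < n 2" "n 2 < n 3"
    and A_nz: "A 1 \<noteq> 0" "A 2 \<noteq> 0" "A 3 \<noteq> 0"
begin

abbreviation "sols \<equiv> nonconst_rat_sols n A"

text \<open>The differential equation for \<open>x = 1 / p\<close>, where
  \<open>x' = - p' / p^2\<close>, multiplied by \<open>p ^ n 3\<close>.\<close>

definition den_eq :: "real poly \<Rightarrow> bool" where
  "den_eq p \<longleftrightarrow> A 3 + A 2 * p ^ (n 3 - n 2) + A 1 * p ^ (n 3 - n 1) + pderiv p * p ^ (n 3 - 2) = 0"

lemma Fract_solves_iff:
  assumes v: "v \<noteq> 0"
  shows "rat_deriv (Fract u v) = Fract (A 3) 1 * Fract u v ^ n 3 + Fract (A 2) 1 * Fract u v ^ n 2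
      + Fract (A 1) 1 * Fract u v ^ n 1 \<longleftrightarrow>
    (pderiv u * v - u * pderiv v) * v ^ (n 3 - 2)
      = A 3 * u ^ n 3 + A 2 * u ^ n 2 * v ^ (n 3 - n 2) + A 1 * u ^ n 1 * v ^ (n 3 - n 1)"
proof -
  let ?W = "pderiv u * v - u * pderiv v"
  have "n 3 = 2 + (n 3 - 2)" using n by simp
  then have "v ^ n 3 = v * v * v ^ (n 3 - 2)"
    by (metis power_add power2_eq_square)
  then have eq: "?W * v ^ n 3 = ?W * v ^ (n 3 - 2) * (v * v)"
    by (simp only: ac_simps)
  have 1: "rat_deriv (Fract u v) = Fract (?W * v ^ (n 3 - 2)) (v ^ n 3)"
    unfolding rat_deriv_Fract[OF v]
    by (rule eq_fract(1)[THEN iffD2, OF _ _ eq]) (use v in auto)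
  have 2: "Fract (A i) 1 * Fract u v ^ n i
      = Fract (A i * u ^ n i * v ^ (n 3 - n i)) (v ^ n 3)" if "n i \<le> n 3" for i
    using Fract_one_mult_power[OF v that] .
  have vN: "v ^ n 3 \<noteq> 0" using v by simp
  have le: "n 1 \<le> n 3" "n 2 \<le> n 3" using n by auto
  show ?thesis
    unfolding 1 2[OF le(1)] 2[OF le(2)] 2[OF order_refl] Fract_add_same[OF vN]
      eq_fract(1)[OF vN vN] using v by auto
qed

lemma sol_imp_den_eq:
  assumes "Fract 1 p \<in> sols" "p \<noteq> 0"
  shows "den_eq p"
proof -
  have "- pderiv p * p ^ (n 3 - 2) = A 3 + A 2 * p ^ (n 3 - n 2) + A 1 * p ^ (n 3 - n 1)"
    using assms Fract_solves_iff[OF assms(2), of 1] by (simp add: nonconst_rat_sols_def)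
  then show ?thesis unfolding den_eq_def by (simp add: algebra_simps eq_neg_iff_add_eq_0)
qed

text \<open>For \<open>u / v\<close> in lowest terms, \<open>u\<close> divides the right-hand side
  after clearing denominators. Coprimality leaves \<open>u dvd pderiv u\<close>, which for degree
  reasons makes \<open>u\<close> constant, and it can be scaled to 1.\<close>

lemma sol_cases:
  assumes x: "x \<in> sols"
  obtains p where "x = Fract 1 p" "degree p \<ge> 1" "den_eq p"
proof -
  obtain u v where uv: "x = Fract u v" "v \<noteq> 0" "coprime u v" by (rule Fract_cases_coprime)
  have eq: "(pderiv u * v - u * pderiv v) * v ^ (n 3 - 2)
      = A 3 * u ^ n 3 + A 2 * u ^ n 2 * v ^ (n 3 - n 2) + A 1 * u ^ n 1 * v ^ (n 3 - n 1)"
    using x Fract_solves_iff[OF uv(2), of u] by (simp add: nonconst_rat_sols_def uv(1))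
  have nc: "x \<noteq> Fract [:c:] 1" for c using x by (auto simp: nonconst_rat_sols_def)
  have "u \<noteq> 0" using nc[of 0] uv(2) by (auto simp: uv(1) eq_fract)
  have "u dvd (pderiv u * v - u * pderiv v) * v ^ (n 3 - 2)"
    unfolding eq using n by (intro dvd_add dvd_mult2 dvd_mult dvd_power) auto
  then have "u dvd pderiv u * v - u * pderiv v"
    using uv(3) by (simp add: coprime_dvd_mult_left_iff)
  then have "u dvd pderiv u * v"
    by (metis dvd_triv_left diff_add_cancel dvd_add)
  then have "u dvd pderiv u" using uv(3) by (simp add: coprime_dvd_mult_left_iff)
  have "degree u = 0"
  proof (rule ccontr)
    assume *: "degree u \<noteq> 0"
    then have "pderiv u \<noteq> 0" by (simp add: pderiv_eq_0_iff)
    from dvd_imp_degree_le[OF \<open>u dvd pderiv u\<close> this] * show False by (simp add: degree_pderiv)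
  qed
  then obtain c where c: "u = [:c:]" by (rule degree_eq_zeroE)
  define p where "p = smult (inverse c) v"
  have "c \<noteq> 0" using c \<open>u \<noteq> 0\<close> by auto
  then have xp: "x = Fract 1 p" "p \<noteq> 0" using uv(2) by (auto simp: uv(1) eq_fract p_def c)
  have "degree p \<noteq> 0"
  proof
    assume "degree p = 0"
    then obtain d where d: "p = [:d:]" by (rule degree_eq_zeroE)
    with xp(2) have "d \<noteq> 0" by auto
    then have "1 * 1 = [:inverse d:] * p" by (simp add: d)
    then have "x = Fract [:inverse d:] 1"
      unfolding xp(1) using xp(2) by (intro eq_fract(1)[THEN iffD2]) auto
    with nc show False by blast
  qed
  then show ?thesis using that[OF xp(1)] sol_imp_den_eq x xp by auto
qed

lemma Gamma_solE:
  assumes "\<rho> \<in> Gamma_sol n A"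
  obtains p where "degree p = \<rho>" "\<rho> \<ge> 1" "den_eq p"
proof -
  obtain p where p: "\<rho> = degree p" "degree p \<ge> 1" "Fract 1 p \<in> sols"
    using assms by (auto simp: Gamma_sol_def)
  then have "p \<noteq> 0" by auto
  with p show ?thesis using that sol_imp_den_eq by blast
qed

subsection \<open>Edge polynomials at solutions\<close>

lemma in_tie_set_iff:
  "l \<in> tie_set n A \<rho> \<longleftrightarrow> l \<in> tie_indices \<and> (\<forall>m\<in>tie_indices. \<Phi> n A \<rho> l \<le> \<Phi> n A \<rho> m)"
proof -
  have "finite (\<Phi> n A \<rho> ` tie_indices)" "\<Phi> n A \<rho> ` tie_indices \<noteq> {}"
    by (auto simp: tie_indices_def)
  then show ?thesis
    unfolding tie_set_def min_order_def
    by (auto intro: antisym simp: Min_le_iff eq_Min_iff)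
qed

lemma min_order_le: "l \<in> tie_indices \<Longrightarrow> min_order n A \<rho> \<le> \<Phi> n A \<rho> l"
  unfolding min_order_def by (intro Min_le) (auto simp: tie_indices_def)

text \<open>The value 0 at untied indices gives the edge polynomial a single four-term form for all
  tie sets.\<close>

definition edge_coeff :: "nat \<Rightarrow> nat \<Rightarrow> real" where
  "edge_coeff \<rho> i = (if Term i \<in> tie_set n A \<rho> then lead_coeff (A i) else 0)"

definition edge_dcoeff :: "nat \<Rightarrow> real" where
  "edge_dcoeff \<rho> = (if Deriv \<in> tie_set n A \<rho> then real \<rho> else 0)"

lemma edge_poly_eq:
  "edge_poly n A \<rho> = monom (edge_dcoeff \<rho>) 1 + monom (edge_coeff \<rho> 1) (n 1)
    + monom (edge_coeff \<rho> 2) (n 2) + monom (edge_coeff \<rho> 3) (n 3)"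
proof -
  have "(\<Sum>i | i \<in> {1, 2, 3} \<and> Term i \<in> tie_set n A \<rho>. monom (lead_coeff (A i)) (n i))
      = (\<Sum>i\<in>{1, 2, 3}. monom (edge_coeff \<rho> i) (n i))"
    by (subst sum.inter_filter) (auto simp: edge_coeff_def intro!: sum.cong)
  then show ?thesis by (simp add: edge_poly_def edge_dcoeff_def)
qed

text \<open>With \<open>\<rho>\<close> the degree of \<open>p\<close>, the number \<open>D\<close> bounds the degrees of all terms of
  \<open>den_eq p\<close>, and the ties are the terms of degree \<open>D\<close>.\<close>

lemma tie_boundsE:
  obtains D d where
    "\<forall>i\<in>{1, 2, 3}. D = d i + (n 3 - n i) * \<rho> \<and> degree (A i) \<le> d i \<and>
      coeff (A i) (d i) = edge_coeff \<rho> i"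
    "(n 3 - 1) * \<rho> \<le> D + 1"
    "(n 3 - 1) * \<rho> = D + 1 \<longleftrightarrow> Deriv \<in> tie_set n A \<rho>"
proof -
  define M where "M = min_order n A \<rho>"
  \<comment> \<open>The largest degree that \<open>A i\<close> may have for its order to be at least
    \<open>M\<close>; a tie means that it is attained. The difference is at least
    \<open>degree (A i)\<close>, so \<open>nat\<close> does not truncate.\<close>
  define d where "d i = nat (int (n i) * int \<rho> - M)" for i
  have M_le: "M \<le> int (n i) * int \<rho> - int (degree (A i))" if "i \<in> {1, 2, 3}" for i
    using min_order_le[of "Term i" \<rho>] that by (auto simp: M_def tie_indices_def)
  then have d: "int (d i) = int (n i) * int \<rho> - M" if "i \<in> {1, 2, 3}" for i
    using that unfolding d_def by force
  have le: "n i \<le> n 3" if "i \<in> {1, 2, 3}" for i using that n by auto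
  have k: "int ((n 3 - n i) * \<rho>) = int (n 3) * int \<rho> - int (n i) * int \<rho>"
    if "i \<in> {1, 2, 3}" for i
    using le[OF that] by (simp add: of_nat_diff left_diff_distrib)
  have k1: "int ((n 3 - 1) * \<rho>) = int (n 3) * int \<rho> - int \<rho>"
    using n by (simp add: of_nat_diff left_diff_distrib)
  have d3: "int (d 3) = int (n 3) * int \<rho> - M" by (rule d) simp
  show ?thesis
  proof (rule that[of "d 3" d], intro ballI conjI)
    fix i :: nat assume i: "i \<in> {1, 2, 3}"
    show "d 3 = d i + (n 3 - n i) * \<rho>"
      using d[OF i] d3 k[OF i] by linarith
    show deg: "degree (A i) \<le> d i" using d[OF i] M_le[OF i] by linarith
    have "Term i \<in> tie_set n A \<rho> \<longleftrightarrow> int (degree (A i)) = int (d i)"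
      using i d[OF i] by (auto simp: tie_set_def tie_indices_def M_def)
    then show "coeff (A i) (d i) = edge_coeff \<rho> i"
      using deg by (auto simp: edge_coeff_def intro: coeff_eq_0)
  next
    \<comment> \<open>The order of the derivative term bounds \<open>M\<close>; the 1 in
      \<open>d 3 + 1\<close> is the degree lost in differentiating
      \<open>p ^ (n 3 - 1)\<close>.\<close>
    have M': "M \<le> int \<rho> + 1"
      using min_order_le[of Deriv \<rho>] by (auto simp: M_def tie_indices_def)
    then show "(n 3 - 1) * \<rho> \<le> d 3 + 1" using d3 k1 by linarith
    have "Deriv \<in> tie_set n A \<rho> \<longleftrightarrow> M = int \<rho> + 1"
      by (auto simp: tie_set_def tie_indices_def M_def)
    then show "(n 3 - 1) * \<rho> = d 3 + 1 \<longleftrightarrow> Deriv \<in> tie_set n A \<rho>"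
      using d3 k1 by linarith
  qed
qed

lemma coeff_pderiv_top:
  assumes "degree P \<le> e" "e \<le> D + 1"
  shows "coeff (pderiv P) D = (if e = D + 1 then real e * coeff P e else 0)"
  using assms by (auto simp: coeff_pderiv coeff_eq_0)

text \<open>Rewrites the derivative term of \<open>den_eq\<close> through the derivative of a power,
  whose top coefficient is known from \<open>coeff_pderiv_top\<close>.\<close>

lemma pderiv_power_N:
  "pderiv (p ^ (n 3 - 1)) = smult (real (n 3 - 1)) (pderiv p * p ^ (n 3 - 2))"
  by (simp add: pderiv_power mult.commute numeral_2_eq_2)

lemma power_inverse_shift:
  fixes g c :: real
  assumes "g * c = 1" "k \<le> m" shows "g ^ (m - k) * c ^ m = c ^ k"
proof -
  have "c ^ m = c ^ (m - k) * c ^ k" using assms by (simp flip: power_add)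
  then show ?thesis using assms by (simp add: mult.assoc[symmetric] flip: power_mult_distrib)
qed

text \<open>In the coefficient of degree \<open>D\<close> of \<open>den_eq p\<close> only tied terms
  survive, each with a power of \<open>\<gamma>\<close>. Multiplication by
  \<open>inverse \<gamma> ^ n 3\<close> turns it into the edge polynomial at
  \<open>inverse \<gamma>\<close>.\<close>

lemma edge_poly_root:
  assumes p: "den_eq p" "degree p \<ge> 1"
  shows "poly (edge_poly n A (degree p)) (inverse (lead_coeff p)) = 0"
proof -
  define \<rho> \<gamma> where "\<rho> = degree p" and "\<gamma> = lead_coeff p"
  define N where "N = n 3 - 1"
  obtain D d where Dd: "\<forall>i\<in>{1, 2, 3}. D = d i + (n 3 - n i) * \<rho> \<and> degree (A i) \<le> d i \<and>
      coeff (A i) (d i) = edge_coeff \<rho> i"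
    and N: "(n 3 - 1) * \<rho> \<le> D + 1" "(n 3 - 1) * \<rho> = D + 1 \<longleftrightarrow> Deriv \<in> tie_set n A \<rho>"
    by (rule tie_boundsE[of \<rho>])
  have D: "D = d i + (n 3 - n i) * \<rho>" and d: "degree (A i) \<le> d i"
    and c: "coeff (A i) (d i) = edge_coeff \<rho> i" if "i \<in> {1, 2, 3}" for i
    using Dd that by blast+
  have \<rho>: "degree p \<le> \<rho>" and g: "coeff p \<rho> = \<gamma>" by (simp_all add: \<rho>_def \<gamma>_def)
  have "\<gamma> \<noteq> 0" using p(2) by (auto simp: \<gamma>_def)
  have tm: "coeff (A i * p ^ (n 3 - n i)) D = edge_coeff \<rho> i * \<gamma> ^ (n 3 - n i)"
    if "i \<in> {1, 2, 3}" for i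
    unfolding D[OF that]
    using coeff_mult_at_degree_bounds[OF d[OF that] degree_power_bound[OF \<rho>]]
      coeff_power_at_degree_bound[OF \<rho>] c[OF that] g by simp
  have "real N * coeff (pderiv p * p ^ (n 3 - 2)) D = coeff (pderiv (p ^ N)) D"
    unfolding N_def pderiv_power_N by simp
  also have "\<dots> = real N * (edge_dcoeff \<rho> * \<gamma> ^ N)"
    using coeff_pderiv_top[OF degree_power_bound[OF \<rho>] N(1)[folded N_def]]
      coeff_power_at_degree_bound[OF \<rho>] g N(2)
    by (simp add: N_def edge_dcoeff_def)
  finally have dterm: "coeff (pderiv p * p ^ (n 3 - 2)) D = edge_dcoeff \<rho> * \<gamma> ^ N"
    using n by (simp add: N_def)
  have "0 = coeff (A 3 * p ^ (n 3 - n 3) + A 2 * p ^ (n 3 - n 2) + A 1 * p ^ (n 3 - n 1)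
      + pderiv p * p ^ (n 3 - 2)) D"
    using p(1) by (simp add: den_eq_def)
  also have "\<dots> = edge_coeff \<rho> 3 * \<gamma> ^ (n 3 - n 3) + edge_coeff \<rho> 2 * \<gamma> ^ (n 3 - n 2)
      + edge_coeff \<rho> 1 * \<gamma> ^ (n 3 - n 1) + edge_dcoeff \<rho> * \<gamma> ^ (n 3 - 1)"
    unfolding coeff_add using tm[of 1] tm[of 2] tm[of 3] dterm N_def by simp
  finally have "0 = (edge_coeff \<rho> 3 * \<gamma> ^ (n 3 - n 3) + edge_coeff \<rho> 2 * \<gamma> ^ (n 3 - n 2)
      + edge_coeff \<rho> 1 * \<gamma> ^ (n 3 - n 1) + edge_dcoeff \<rho> * \<gamma> ^ (n 3 - 1)) * inverse \<gamma> ^ n 3"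
    by simp
  also have "\<dots> = edge_coeff \<rho> 3 * (\<gamma> ^ (n 3 - n 3) * inverse \<gamma> ^ n 3)
      + edge_coeff \<rho> 2 * (\<gamma> ^ (n 3 - n 2) * inverse \<gamma> ^ n 3)
      + edge_coeff \<rho> 1 * (\<gamma> ^ (n 3 - n 1) * inverse \<gamma> ^ n 3)
      + edge_dcoeff \<rho> * (\<gamma> ^ (n 3 - 1) * inverse \<gamma> ^ n 3)"
    by (simp only: distrib_right mult.assoc)
  also have "\<dots> = poly (edge_poly n A \<rho>) (inverse \<gamma>)"
  proof -
    have "\<gamma> ^ (n 3 - k) * inverse \<gamma> ^ n 3 = inverse \<gamma> ^ k" if "k \<in> {1, n 1, n 2, n 3}" for k
      using that n \<open>\<gamma> \<noteq> 0\<close> by (intro power_inverse_shift) auto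
    from this[of 1] this[of "n 1"] this[of "n 2"] this[of "n 3"] show ?thesis
      by (simp add: edge_poly_eq poly_monom)
  qed
  finally show ?thesis by (simp add: \<rho>_def \<gamma>_def)
qed

text \<open>Subtracting the equations of \<open>p\<close> and \<open>q\<close> removes
  \<open>A 3\<close>, and the top coefficient of the difference is a linear relation among the other
  edge coefficients. Together with the root equation it determines the derivative at
  \<open>C\<close>.\<close>

lemma edge_poly_pderiv_root:
  assumes p: "den_eq p" "degree p \<ge> 1" and q: "den_eq q"
    and deg: "degree q = degree p" and lc: "lead_coeff q = lead_coeff p" and ne: "p \<noteq> q"
  shows "poly (pderiv (edge_poly n A (degree p))) (inverse (lead_coeff p))
    = (if Deriv \<in> tie_set n A (degree p) then real (degree (p - q)) - real (degree p) else 0)"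
    and "degree (p - q) < degree p"
proof -
  define \<rho> \<gamma> where "\<rho> = degree p" and "\<gamma> = lead_coeff p"
  define s \<delta> where "s = degree (p - q)" and "\<delta> = lead_coeff (p - q)"
  define C where "C = inverse \<gamma>"
  define N where "N = n 3 - 2"
  define t where "t = (if Deriv \<in> tie_set n A \<rho> then 1 else 0 :: real)"
  obtain D d where Dd: "\<forall>i\<in>{1, 2, 3}. D = d i + (n 3 - n i) * \<rho> \<and> degree (A i) \<le> d i \<and>
      coeff (A i) (d i) = edge_coeff \<rho> i"
    and N: "(n 3 - 1) * \<rho> \<le> D + 1" "(n 3 - 1) * \<rho> = D + 1 \<longleftrightarrow> Deriv \<in> tie_set n A \<rho>"
    by (rule tie_boundsE[of \<rho>])
  have D: "D = d i + (n 3 - n i) * \<rho>" and d: "degree (A i) \<le> d i"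
    and c: "coeff (A i) (d i) = edge_coeff \<rho> i" if "i \<in> {1, 2, 3}" for i
    using Dd that by blast+
  have p_deg: "degree p \<le> \<rho>" "degree q \<le> \<rho>" "coeff p \<rho> = \<gamma>" "coeff q \<rho> = \<gamma>"
    using deg lc by (simp_all add: \<rho>_def \<gamma>_def)
  have "\<gamma> \<noteq> 0" using p(2) by (auto simp: \<gamma>_def)
  have "p - q \<noteq> 0" using ne by simp
  then have "\<delta> \<noteq> 0" unfolding \<delta>_def by (simp only: leading_coeff_0_iff not_False_eq_True)
  have "s \<le> \<rho>" unfolding s_def using degree_diff_le p_deg by blast
  moreover have "s \<noteq> \<rho>"
  proof
    assume "s = \<rho>"
    then have "\<delta> = coeff (p - q) \<rho>" by (simp only: \<delta>_def s_def)
    with p_deg \<open>\<delta> \<noteq> 0\<close> show False by simp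
  qed
  ultimately have "s < \<rho>" by simp
  then show "degree (p - q) < degree p" by (simp add: s_def \<rho>_def)
  have top: "degree (p ^ Suc k - q ^ Suc k) \<le> k * \<rho> + s"
    "coeff (p ^ Suc k - q ^ Suc k) (k * \<rho> + s) = real (Suc k) * \<gamma> ^ k * \<delta>" for k
    using power_diff_top[of p \<rho> q s k] p_deg by (simp_all add: s_def \<delta>_def)
  have N3: "n 3 - 1 = Suc N" using n by (simp add: N_def)
  \<comment> \<open>Passing from \<open>p ^ k\<close> to \<open>p ^ k - q ^ k\<close> lowers the
    degree bound from \<open>k * \<rho>\<close> to \<open>(k - 1) * \<rho> + s\<close>, so the
    common bound \<open>D\<close> drops by \<open>\<rho> - s\<close>.\<close>
  define E where "E = D + s - \<rho>"
  have D_ge: "\<rho> \<le> D" using D[of 2] n by (cases "n 3 - n 2") auto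
  have E: "E + \<rho> = D + s" using D_ge by (simp add: E_def)
  have tm: "coeff (A i * (p ^ (n 3 - n i) - q ^ (n 3 - n i))) E
      = edge_coeff \<rho> i * (real (n 3 - n i) * \<gamma> ^ (n 3 - 1 - n i)) * \<delta>"
    if i: "i \<in> {1, 2}" for i
  proof -
    have i': "i \<in> {1, 2, 3}" using i by auto
    obtain k where k: "n 3 - n i = Suc k" using i n by (cases "n 3 - n i") auto
    then have k': "n 3 - 1 - n i = k" by simp
    have "E = d i + (k * \<rho> + s)" using E D[OF i'] by (simp add: k)
    then show ?thesis
      unfolding k k'
      using coeff_mult_at_degree_bounds[OF d[OF i'] top(1)[of k]] top(2)[of k] c[OF i']
      by (simp del: power_Suc)
  qed
  have "real (n 3 - 1) * coeff (pderiv p * p ^ (n 3 - 2) - pderiv q * q ^ (n 3 - 2)) E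
      = coeff (pderiv (p ^ (n 3 - 1) - q ^ (n 3 - 1))) E"
    unfolding pderiv_diff pderiv_power_N by (simp add: right_diff_distrib)
  also have "\<dots> = real (n 3 - 1) * (t * (real N * real \<rho> + real s) * \<gamma> ^ N * \<delta>)"
  proof -
    \<comment> \<open>Both sides of the comparison drop by \<open>\<rho> - s\<close>, so the
      derivative term reaches degree \<open>E\<close> exactly when it is tied.\<close>
    have "N * \<rho> + s \<le> E + 1" "N * \<rho> + s = E + 1 \<longleftrightarrow> (n 3 - 1) * \<rho> = D + 1"
      using N(1) E unfolding N3 by auto
    then show ?thesis
      unfolding N3 using coeff_pderiv_top[OF top(1)[of N], of E] top(2)[of N] N(2)[unfolded N3]
      by (simp add: t_def N3 del: power_Suc)
  qed
  finally have dterm: "coeff (pderiv p * p ^ (n 3 - 2) - pderiv q * q ^ (n 3 - 2)) E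
      = t * (real N * real \<rho> + real s) * \<gamma> ^ N * \<delta>"
    using n by simp
  have "A 2 * (p ^ (n 3 - n 2) - q ^ (n 3 - n 2)) + A 1 * (p ^ (n 3 - n 1) - q ^ (n 3 - n 1))
      + (pderiv p * p ^ (n 3 - 2) - pderiv q * q ^ (n 3 - 2))
    = (A 3 + A 2 * p ^ (n 3 - n 2) + A 1 * p ^ (n 3 - n 1) + pderiv p * p ^ (n 3 - 2))
      - (A 3 + A 2 * q ^ (n 3 - n 2) + A 1 * q ^ (n 3 - n 1) + pderiv q * q ^ (n 3 - 2))"
    by (simp add: right_diff_distrib)
  also have "\<dots> = 0" using p(1) q by (simp add: den_eq_def)
  finally have "coeff (A 2 * (p ^ (n 3 - n 2) - q ^ (n 3 - n 2))
      + A 1 * (p ^ (n 3 - n 1) - q ^ (n 3 - n 1))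
      + (pderiv p * p ^ (n 3 - 2) - pderiv q * q ^ (n 3 - 2))) E = 0"
    by simp
  then have "(edge_coeff \<rho> 2 * (real (n 3 - n 2) * \<gamma> ^ (n 3 - 1 - n 2))
      + edge_coeff \<rho> 1 * (real (n 3 - n 1) * \<gamma> ^ (n 3 - 1 - n 1))
      + t * (real N * real \<rho> + real s) * \<gamma> ^ N) * \<delta> = 0"
    unfolding coeff_add dterm tm[of 2, OF insertI2[OF insertI1]] tm[of 1, OF insertI1]
    by (simp add: distrib_right)
  then have "(edge_coeff \<rho> 2 * (real (n 3 - n 2) * \<gamma> ^ (n 3 - 1 - n 2))
      + edge_coeff \<rho> 1 * (real (n 3 - n 1) * \<gamma> ^ (n 3 - 1 - n 1))
      + t * (real N * real \<rho> + real s) * \<gamma> ^ (n 3 - 1 - 1)) * C ^ (n 3 - 1) = 0"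
    using \<open>\<delta> \<noteq> 0\<close> by (simp add: N_def numeral_2_eq_2)
  then have "edge_coeff \<rho> 2 * real (n 3 - n 2) * (\<gamma> ^ (n 3 - 1 - n 2) * C ^ (n 3 - 1))
      + edge_coeff \<rho> 1 * real (n 3 - n 1) * (\<gamma> ^ (n 3 - 1 - n 1) * C ^ (n 3 - 1))
      + t * (real N * real \<rho> + real s) * (\<gamma> ^ (n 3 - 1 - 1) * C ^ (n 3 - 1)) = 0"
    by (simp only: distrib_right mult.assoc)
  moreover have "\<gamma> ^ (n 3 - 1 - k) * C ^ (n 3 - 1) = C ^ k" if "k \<in> {1, n 1, n 2}" for k
    using that n \<open>\<gamma> \<noteq> 0\<close> by (intro power_inverse_shift) (auto simp: C_def)
  ultimately have lin: "edge_coeff \<rho> 2 * real (n 3 - n 2) * C ^ n 2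
      + edge_coeff \<rho> 1 * real (n 3 - n 1) * C ^ n 1
      + t * (real N * real \<rho> + real s) * C = 0"
    by simp
  have root: "edge_dcoeff \<rho> * C + edge_coeff \<rho> 1 * C ^ n 1 + edge_coeff \<rho> 2 * C ^ n 2
      + edge_coeff \<rho> 3 * C ^ n 3 = 0"
    using edge_poly_root[OF p] by (simp add: edge_poly_eq poly_monom \<rho>_def \<gamma>_def C_def)
  have "C * poly (pderiv (edge_poly n A \<rho>)) C = edge_dcoeff \<rho> * C
      + edge_coeff \<rho> 1 * real (n 1) * C ^ n 1 + edge_coeff \<rho> 2 * real (n 2) * C ^ n 2
      + edge_coeff \<rho> 3 * real (n 3) * C ^ n 3"
  proof -
    have pow: "C ^ n 1 = C * C ^ (n 1 - 1)" "C ^ n 2 = C * C ^ (n 2 - 1)"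
      "C ^ n 3 = C * C ^ (n 3 - 1)"
      using n by (simp_all flip: power_Suc)
    have "poly (pderiv (edge_poly n A \<rho>)) C = edge_dcoeff \<rho>
      + real (n 1) * edge_coeff \<rho> 1 * C ^ (n 1 - 1) + real (n 2) * edge_coeff \<rho> 2 * C ^ (n 2 - 1)
      + real (n 3) * edge_coeff \<rho> 3 * C ^ (n 3 - 1)"
      by (simp add: edge_poly_eq pderiv_add pderiv_monom poly_monom)
    then show ?thesis by (simp only: pow algebra_simps)
  qed
  also have "\<dots> = C * (t * (real s - real \<rho>))"
  proof -
    have eqs: "edge_dcoeff \<rho> = t * real \<rho>" "real (n 3 - n 1) = real (n 3) - real (n 1)"
      "real (n 3 - n 2) = real (n 3) - real (n 2)" "real N = real (n 3) - 2"
      using n by (simp_all add: N_def of_nat_diff edge_dcoeff_def t_def)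
    \<comment> \<open>Taking \<open>n 3\<close> times the root equation minus the linear relation
      restores the weights \<open>n 1\<close>, \<open>n 2\<close>, \<open>n 3\<close>; only the
      derivative terms leave a remainder.\<close>
    have "edge_dcoeff \<rho> * C + edge_coeff \<rho> 1 * real (n 1) * C ^ n 1
        + edge_coeff \<rho> 2 * real (n 2) * C ^ n 2 + edge_coeff \<rho> 3 * real (n 3) * C ^ n 3
      = real (n 3) * (edge_dcoeff \<rho> * C + edge_coeff \<rho> 1 * C ^ n 1
          + edge_coeff \<rho> 2 * C ^ n 2 + edge_coeff \<rho> 3 * C ^ n 3)
        - (edge_coeff \<rho> 2 * real (n 3 - n 2) * C ^ n 2
          + edge_coeff \<rho> 1 * real (n 3 - n 1) * C ^ n 1
          + t * (real N * real \<rho> + real s) * C)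
        + C * (t * (real s - real \<rho>))"
      unfolding eqs by (simp add: algebra_simps)
    then show ?thesis unfolding lin root by simp
  qed
  finally have "poly (pderiv (edge_poly n A \<rho>)) C = t * (real s - real \<rho>)"
    using \<open>\<gamma> \<noteq> 0\<close> by (simp add: C_def)
  then show "poly (pderiv (edge_poly n A (degree p))) (inverse (lead_coeff p))
    = (if Deriv \<in> tie_set n A (degree p) then real (degree (p - q)) - real (degree p) else 0)"
    by (simp add: t_def C_def s_def \<rho>_def \<gamma>_def)
qed

end

subsection \<open>Consequences of nondegeneracy\<close>

text \<open>The common root is a linear factor of the gcd, which is nonzero because \<open>f\<close>
  is.\<close>

lemma resultant_eq_0_common_root:
  fixes f g :: "real poly"
  assumes "f \<noteq> 0" "poly f c = 0" "poly g c = 0"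
  shows "resultant f g = 0"
proof -
  have "[:-c, 1:] dvd gcd f g" using assms by (simp add: poly_eq_0_iff_dvd)
  then have "degree [:-c, 1:] \<le> degree (gcd f g)"
    using assms by (intro dvd_imp_degree_le) auto
  then show ?thesis by (simp add: resultant_0_gcd)
qed

context three_term
begin

lemma finite_tie_set: "finite (tie_set n A \<rho>)"
  unfolding tie_set_def tie_indices_def by auto

lemma tie_set_subset: "tie_set n A \<rho> \<subseteq> {Term 3, Term 2, Term 1, Deriv}"
  unfolding tie_set_def tie_indices_def by auto

lemma tie_set_nonempty: "tie_set n A \<rho> \<noteq> {}"
proof -
  have "min_order n A \<rho> \<in> \<Phi> n A \<rho> ` tie_indices"
    unfolding min_order_def by (intro Min_in) (auto simp: tie_indices_def)
  then show ?thesis by (auto simp: tie_set_def)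
qed

lemma edge_coeff_eq_0_iff: "i \<in> {1, 2, 3} \<Longrightarrow> edge_coeff \<rho> i = 0 \<longleftrightarrow> Term i \<notin> tie_set n A \<rho>"
  using A_nz by (auto simp: edge_coeff_def)

lemma edge_dcoeff_eq_0_iff: "\<rho> \<ge> 1 \<Longrightarrow> edge_dcoeff \<rho> = 0 \<longleftrightarrow> Deriv \<notin> tie_set n A \<rho>"
  by (auto simp: edge_dcoeff_def)

text \<open>The exponents 1, \<open>n 1\<close>, \<open>n 2\<close>, \<open>n 3\<close> are
  distinct, so nothing cancels, and some index always attains the minimal order.\<close>

lemma edge_poly_nonzero:
  assumes "\<rho> \<ge> 1" shows "edge_poly n A \<rho> \<noteq> 0"
proof
  assume 0: "edge_poly n A \<rho> = 0"
  have "coeff (edge_poly n A \<rho>) 1 = edge_dcoeff \<rho>"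
    "coeff (edge_poly n A \<rho>) (n 1) = edge_coeff \<rho> 1"
    "coeff (edge_poly n A \<rho>) (n 2) = edge_coeff \<rho> 2"
    "coeff (edge_poly n A \<rho>) (n 3) = edge_coeff \<rho> 3"
    using n by (auto simp: edge_poly_eq)
  with 0 have "tie_set n A \<rho> = {}"
    using edge_coeff_eq_0_iff[of _ \<rho>] edge_dcoeff_eq_0_iff[OF assms] tie_set_subset[of \<rho>]
    by fastforce
  with tie_set_nonempty show False by simp
qed

text \<open>A single tie would make the edge polynomial a monomial, which has no nonzero
  roots.\<close>

lemma two_ties:
  assumes "\<rho> \<ge> 1" "nz_roots (edge_poly n A \<rho>) \<noteq> {}"
  shows "card (tie_set n A \<rho>) \<ge> 2"
proof (rule ccontr)
  assume "\<not> ?thesis"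
  then have "card (tie_set n A \<rho>) = 1"
    using finite_tie_set[of \<rho>] tie_set_nonempty[of \<rho>]
    by (simp add: card_gt_0_iff le_less_Suc_eq not_le numeral_2_eq_2 Suc_leI)
  then obtain l where l: "tie_set n A \<rho> = {l}" by (auto simp: card_1_singleton_iff)
  then have "l \<in> {Term 3, Term 2, Term 1, Deriv}" using tie_set_subset[of \<rho>] by auto
  then consider i where "l = Term i" "i \<in> {1, 2, 3}" | "l = Deriv" by blast
  then have "\<exists>c k. c \<noteq> 0 \<and> edge_poly n A \<rho> = monom c k"
  proof cases
    case 1
    then have "lead_coeff (A i) \<noteq> 0" "edge_poly n A \<rho> = monom (lead_coeff (A i)) (n i)"
      using A_nz by (auto simp: edge_poly_eq edge_coeff_def edge_dcoeff_def l)
    then show ?thesis by blast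
  next
    case 2
    then have "edge_poly n A \<rho> = monom (real \<rho>) 1"
      by (simp add: edge_poly_eq edge_coeff_def edge_dcoeff_def l)
    then show ?thesis using assms(1) by (intro exI[of _ "real \<rho>"] exI[of _ 1]) auto
  qed
  with assms(2) show False by auto
qed

lemma reduced_edge_poly_mult:
  "edge_poly n A \<rho> = monom 1 (order 0 (edge_poly n A \<rho>)) * reduced_edge_poly n A \<rho>"
proof -
  have "monom 1 (order 0 (edge_poly n A \<rho>)) dvd edge_poly n A \<rho>"
    using order_1[of 0 "edge_poly n A \<rho>"] by (simp add: monom_altdef)
  then show ?thesis unfolding reduced_edge_poly_def by simp
qed

lemma reduced_edge_poly_root_iff:
  assumes "c \<noteq> 0"
  shows "poly (reduced_edge_poly n A \<rho>) c = 0 \<longleftrightarrow> poly (edge_poly n A \<rho>) c = 0"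
  using arg_cong[OF reduced_edge_poly_mult[of \<rho>], of "\<lambda>p. poly p c"] assms
  by (auto simp: poly_monom)

lemma reduced_edge_poly_nonzero: "\<rho> \<ge> 1 \<Longrightarrow> reduced_edge_poly n A \<rho> \<noteq> 0"
  using edge_poly_nonzero[of \<rho>] reduced_edge_poly_mult[of \<rho>] by auto

text \<open>By the product rule, a double root away from 0 would also be a double root of the
  reduced edge polynomial, making the resultant in (ND1) vanish.\<close>

lemma ND1_simple_root:
  assumes "ND1 n A \<rho>" "\<rho> \<ge> 1" "c \<noteq> 0" "poly (edge_poly n A \<rho>) c = 0"
  shows "poly (pderiv (edge_poly n A \<rho>)) c \<noteq> 0"
proof
  assume 0: "poly (pderiv (edge_poly n A \<rho>)) c = 0"
  define e where "e = order 0 (edge_poly n A \<rho>)"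
  have R: "poly (reduced_edge_poly n A \<rho>) c = 0"
    using assms reduced_edge_poly_root_iff by blast
  have "pderiv (edge_poly n A \<rho>) = monom 1 e * pderiv (reduced_edge_poly n A \<rho>)
      + reduced_edge_poly n A \<rho> * pderiv (monom 1 e)"
    using reduced_edge_poly_mult[of \<rho>] pderiv_mult unfolding e_def by metis
  with 0 R assms(3) have "poly (pderiv (reduced_edge_poly n A \<rho>)) c = 0"
    by (simp add: poly_monom)
  with R have "resultant (reduced_edge_poly n A \<rho>) (pderiv (reduced_edge_poly n A \<rho>)) = 0"
    using reduced_edge_poly_nonzero[OF assms(2)] by (rule resultant_eq_0_common_root[rotated])
  with assms(1) show False by (simp add: ND1_def)
qed

text \<open>Opposite roots would give the reduced edge polynomial and its reflection the common root
  \<open>c\<close>; \<open>even (n 3 - 1)\<close> activates the resultant condition.\<close>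

lemma ND3b_no_opposite_roots:
  assumes "ND3b n A \<rho>" "even (n 3 - 1)" "\<rho> \<ge> 1" "c \<noteq> 0" "poly (edge_poly n A \<rho>) c = 0"
  shows "poly (edge_poly n A \<rho>) (- c) \<noteq> 0"
proof
  assume "poly (edge_poly n A \<rho>) (- c) = 0"
  then have "poly (reduced_edge_poly n A \<rho>) (- c) = 0"
    using assms(4) reduced_edge_poly_root_iff[of "- c"] by simp
  moreover have "poly (reduced_edge_poly n A \<rho>) c = 0"
    using assms reduced_edge_poly_root_iff by blast
  ultimately have "resultant (reduced_edge_poly n A \<rho>)
      (pcompose (reduced_edge_poly n A \<rho>) [:0, -1:]) = 0"
    using reduced_edge_poly_nonzero[OF assms(3)]
    by (intro resultant_eq_0_common_root[of _ c]) (auto simp: poly_pcompose)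
  with assms(1,2) show False unfolding ND3b_def by blast
qed

text \<open>All terms of \<open>den_eq p\<close> other than \<open>A 3\<close> are divisible by
  \<open>p ^ (n 3 - n 2)\<close>, hence so is \<open>A 3\<close>. This is the bound
  \<open>r_0\<close> on candidate degrees.\<close>

lemma degree_den_le:
  assumes "den_eq p" shows "(n 3 - n 2) * degree p \<le> degree (A 3)"
proof -
  have "p ^ (n 3 - n 2) dvd
      - (A 2 * p ^ (n 3 - n 2) + A 1 * p ^ (n 3 - n 1) + pderiv p * p ^ (n 3 - 2))"
    using n by (simp only: dvd_minus_iff) (intro dvd_add dvd_mult le_imp_power_dvd, auto)
  also have "\<dots> = A 3"
    using assms by (simp only: den_eq_def minus_equation_iff[of _ "A 3"] eq_neg_iff_add_eq_0 ac_simps)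
  finally have "degree (p ^ (n 3 - n 2)) \<le> degree (A 3)" using A_nz by (intro dvd_imp_degree_le)
  moreover have "p \<noteq> 0"
  proof
    assume "p = 0"
    with assms n A_nz show False by (auto simp: den_eq_def power_0_left)
  qed
  ultimately show ?thesis by (simp add: degree_power_eq mult.commute)
qed

lemma cand_pair_eq:
  assumes "\<Phi> n A \<rho> (Term i) = \<Phi> n A \<rho> (Term j)" "n j < n i"
  shows "real \<rho> = cand_pair n A i j"
proof -
  have "real_of_int (\<Phi> n A \<rho> (Term i)) = real_of_int (\<Phi> n A \<rho> (Term j))" using assms(1) by simp
  then show ?thesis using assms(2) by (simp add: cand_pair_def field_simps)
qed

lemma cand_deriv_eq:
  assumes "\<Phi> n A \<rho> (Term i) = \<Phi> n A \<rho> Deriv" "1 < n i"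
  shows "real \<rho> = cand_deriv n A i"
proof -
  have "real_of_int (\<Phi> n A \<rho> (Term i)) = real_of_int (\<Phi> n A \<rho> Deriv)" using assms(1) by simp
  then show ?thesis using assms(2) by (simp add: cand_deriv_def field_simps)
qed

text \<open>Equating the orders of two tied indices and solving for \<open>\<rho>\<close> gives one
  of the six candidate quotients; the last assumption is the bound \<open>r_0\<close>.\<close>

lemma Gamma_candI:
  assumes "\<rho> \<ge> 1" "card (tie_set n A \<rho>) \<ge> 2" "(n 3 - n 2) * \<rho> \<le> degree (A 3)"
  shows "\<rho> \<in> Gamma_cand n A"
proof -
  let ?X = "{(Term 3, Term 2), (Term 3, Term 1), (Term 2, Term 1),
    (Term 3, Deriv), (Term 2, Deriv), (Term 1, Deriv)}"
  let ?S = "{cand_pair n A 3 2, cand_pair n A 3 1, cand_pair n A 2 1,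
    cand_deriv n A 3, cand_deriv n A 2, cand_deriv n A 1}"
  obtain l m where lm: "l \<in> tie_set n A \<rho>" "m \<in> tie_set n A \<rho>" "l \<noteq> m"
    using assms(2) card_le_Suc0_iff_eq[OF finite_tie_set[of \<rho>]] by auto
  then have eq: "\<Phi> n A \<rho> l = \<Phi> n A \<rho> m" by (simp add: tie_set_def)
  have "l \<in> {Term 3, Term 2, Term 1, Deriv}" "m \<in> {Term 3, Term 2, Term 1, Deriv}"
    using lm tie_set_subset[of \<rho>] by blast+
  then have pairs: "(l, m) \<in> ?X \<or> (m, l) \<in> ?X" using lm(3) by auto
  have "real \<rho> \<in> ?S" if "(l, m) \<in> ?X" "\<Phi> n A \<rho> l = \<Phi> n A \<rho> m" for l m
    using that n cand_pair_eq[of \<rho>] cand_deriv_eq[of \<rho>]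
    by (elim insertE emptyE) (simp_all only: prod.inject insert_iff, (meson less_trans)+)
  with pairs eq have "real \<rho> \<in> ?S" by metis
  moreover have "real \<rho> \<le> cand_bound n A"
  proof -
    have "(real (n 3) - real (n 2)) * real \<rho> \<le> real (degree (A 3))"
      using of_nat_mono[OF assms(3), where 'a = real] n by (simp add: of_nat_diff)
    then show ?thesis using n by (simp add: cand_bound_def field_simps)
  qed
  ultimately show ?thesis using assms(1) by (simp add: Gamma_cand_def)
qed

end

section \<open>Injecting solutions into roots of edge polynomials under (ND)\<close>

locale three_term_ND = three_term +
  assumes ND: "ND n A"
begin

lemma den_root:
  assumes "den_eq p" "degree p \<ge> 1"
  shows "inverse (lead_coeff p) \<in> nz_roots (edge_poly n A (degree p))"
  using edge_poly_root[OF assms] assms(2) by (auto simp: nz_roots_def)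

text \<open>Makes (ND), a condition on candidate degrees, available at realized degrees: a solution
  supplies a nonzero root, hence two ties, and divisibility supplies the bound
  \<open>r_0\<close>.\<close>

lemma Gamma_sol_facts:
  assumes "\<rho> \<in> Gamma_sol n A"
  shows "\<rho> \<ge> 1" "nz_roots (edge_poly n A \<rho>) \<noteq> {}" "card (tie_set n A \<rho>) \<ge> 2"
    "ND1 n A \<rho>" "ND2 n A \<rho>" "ND3b n A \<rho>" "\<rho> \<le> degree (A 3)"
proof -
  obtain p where p: "degree p = \<rho>" "\<rho> \<ge> 1" "den_eq p" by (rule Gamma_solE[OF assms])
  show 1: "\<rho> \<ge> 1" by fact
  show 2: "nz_roots (edge_poly n A \<rho>) \<noteq> {}" using den_root[OF p(3)] p by auto
  show 3: "card (tie_set n A \<rho>) \<ge> 2" using two_ties[OF 1 2] .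
  have le: "(n 3 - n 2) * \<rho> \<le> degree (A 3)" using degree_den_le[OF p(3)] p(1) by simp
  then have "\<rho> \<in> Gamma_cand n A" using Gamma_candI 1 3 by blast
  moreover have "edge_admissible n A \<rho>" using 1 3 by (simp add: edge_admissible_def)
  ultimately show "ND1 n A \<rho>" "ND2 n A \<rho>" "ND3b n A \<rho>" using ND by (auto simp: ND_def)
  have "\<rho> \<le> (n 3 - n 2) * \<rho>" using n by (cases "n 3 - n 2") auto
  from this le show "\<rho> \<le> degree (A 3)" by (rule le_trans)
qed

lemma finite_Gamma_sol: "finite (Gamma_sol n A)"
proof (rule finite_subset)
  show "Gamma_sol n A \<subseteq> {..degree (A 3)}" using Gamma_sol_facts(7) by blast
qed simp

text \<open>For distinct denominators the derivative at the shared root would be a negative integer,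
  against (ND2), or 0, against (ND1).\<close>

lemma den_unique:
  assumes p: "den_eq p" "degree p \<in> Gamma_sol n A" and q: "den_eq q"
    and eq: "degree q = degree p" "lead_coeff q = lead_coeff p"
  shows "p = q"
proof (rule ccontr)
  assume ne: "p \<noteq> q"
  define c where "c = inverse (lead_coeff p)"
  define P where "P = edge_poly n A (degree p)"
  note facts = Gamma_sol_facts[OF p(2)]
  have c: "c \<noteq> 0" "poly P c = 0"
    using den_root[OF p(1) facts(1)] by (auto simp: nz_roots_def c_def P_def)
  have P': "poly (pderiv P) c = (if Deriv \<in> tie_set n A (degree p)
      then real (degree (p - q)) - real (degree p) else 0)" and less: "degree (p - q) < degree p"
    using edge_poly_pderiv_root[OF p(1) facts(1) q eq ne] by (simp_all add: c_def P_def)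
  show False
  proof (cases "Deriv \<in> tie_set n A (degree p)")
    case True
    then have "poly (pderiv P) c = real_of_int (int (degree (p - q)) - int (degree p))"
      using P' by simp
    then have "poly (pderiv P) c \<in> real_of_int ` {k. k < 0}" using less
      by (intro image_eqI[where x = "int (degree (p - q)) - int (degree p)"]) auto
    then show False using facts(5) True c by (auto simp: ND2_def P_def)
  next
    case False
    then show False using ND1_simple_root[OF facts(4,1) c(1)] c(2) P' by (simp add: P_def)
  qed
qed

text \<open>The pair of denominator degree and inverse leading coefficient maps the solutions
  injectively into the disjoint union of the root sets.\<close>

lemma card_sols_le:
  "finite sols \<and> card sols \<le> (\<Sum>\<rho>\<in>Gamma_sol n A. card (nz_roots (edge_poly n A \<rho>)))"
proof -
  define den where "den x = (SOME p. x = Fract 1 p \<and> degree p \<ge> 1 \<and> den_eq p)" for x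
  define h where "h x = (degree (den x), inverse (lead_coeff (den x)))" for x
  define B where "B = (SIGMA \<rho>:Gamma_sol n A. nz_roots (edge_poly n A \<rho>))"
  have den: "x = Fract 1 (den x)" "degree (den x) \<ge> 1" "den_eq (den x)" if "x \<in> sols" for x
    using someI_ex[of "\<lambda>p. x = Fract 1 p \<and> degree p \<ge> 1 \<and> den_eq p"] sol_cases[OF that]
    unfolding den_def by metis+
  have Gam: "degree (den x) \<in> Gamma_sol n A" if "x \<in> sols" for x
    unfolding Gamma_sol_def using den[OF that] that by (intro CollectI exI[of _ "den x"]) auto
  have fin: "finite (nz_roots (edge_poly n A \<rho>))" if "\<rho> \<in> Gamma_sol n A" for \<rho>
    using finite_nz_roots edge_poly_nonzero Gamma_sol_facts(1)[OF that] by blast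
  have "inj_on h sols"
  proof (rule inj_onI)
    fix x y assume xy: "x \<in> sols" "y \<in> sols" "h x = h y"
    from xy(3) have deg: "degree (den x) = degree (den y)"
      and inv: "inverse (lead_coeff (den x)) = inverse (lead_coeff (den y))"
      unfolding h_def prod.inject by blast+
    have "den x = den y"
      by (rule den_unique[OF den(3)[OF xy(1)] Gam[OF xy(1)] den(3)[OF xy(2)] deg[symmetric]
        iffD1[OF inverse_eq_iff_eq inv, symmetric]])
    then show "x = y" using den(1) xy by metis
  qed
  moreover have "h ` sols \<subseteq> B" using Gam den den_root by (auto simp: h_def B_def)
  moreover have "finite B" unfolding B_def using fin finite_Gamma_sol by (intro finite_SigmaI)
  moreover have "card B = (\<Sum>\<rho>\<in>Gamma_sol n A. card (nz_roots (edge_poly n A \<rho>)))"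
    unfolding B_def using fin finite_Gamma_sol by (intro card_SigmaI) auto
  ultimately show ?thesis using inj_on_finite card_inj_on_le by metis
qed

text \<open>The root equation fixes \<open>a * c ^ (n i - 1)\<close> as \<open>- \<rho>\<close>, so
  the derivative takes the same forbidden value at every nonzero root.\<close>

lemma tie_set_ne_Term_Deriv:
  assumes "\<rho> \<in> Gamma_sol n A" "i \<in> {1, 2, 3}"
  shows "tie_set n A \<rho> \<noteq> {Term i, Deriv}"
proof
  assume T: "tie_set n A \<rho> = {Term i, Deriv}"
  note facts = Gamma_sol_facts[OF assms(1)]
  define a where "a = lead_coeff (A i)"
  have P: "edge_poly n A \<rho> = monom (real \<rho>) 1 + monom a (n i)"
    using assms(2) by (auto simp: edge_poly_eq edge_coeff_def edge_dcoeff_def T a_def)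
  have ni: "1 < n i" using assms(2) n by auto
  obtain c where c: "c \<noteq> 0" "poly (edge_poly n A \<rho>) c = 0"
    using facts(2) by (auto simp: nz_roots_def)
  have "c ^ n i = c * c ^ (n i - 1)" using ni by (simp flip: power_Suc)
  with c(2) have "c * (real \<rho> + a * c ^ (n i - 1)) = 0"
    by (simp add: P poly_monom algebra_simps)
  then have root: "a * c ^ (n i - 1) = - real \<rho>" using c(1) by simp
  have "poly (pderiv (edge_poly n A \<rho>)) c = real \<rho> + real (n i) * (a * c ^ (n i - 1))"
    by (simp add: P pderiv_add pderiv_monom poly_monom)
  also have "\<dots> = real_of_int (int \<rho> * (1 - int (n i)))"
    unfolding root by (simp add: algebra_simps)
  finally have "poly (pderiv (edge_poly n A \<rho>)) c \<in> real_of_int ` {k. k < 0}"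
    using facts(1) ni
    by (intro image_eqI[where x = "int \<rho> * (1 - int (n i))"]) (auto simp: mult_less_0_iff)
  then show False using facts(5) c T by (auto simp: ND2_def)
qed

end

subsection \<open>Counting solutions\<close>

lemma gap_weight_le: "gap_weight e \<le> 2"
  by (simp add: gap_weight_def)

section \<open>Which ties survive below the maximal degree\<close>

context three_term_ND
begin

text \<open>The difference of the orders of \<open>Term i\<close> and \<open>Term j\<close> grows
  strictly with the degree. It is at most 0 at \<open>r\<close>, hence negative at
  \<open>\<rho>\<close>, where \<open>Term j\<close> then is not minimal.\<close>

lemma Term_not_tied_below:
  assumes T: "Term i \<in> tie_set n A r" and ij: "i \<in> {1, 2, 3}" "j \<in> {1, 2, 3}"
    and less: "\<rho> < r" "n j < n i"
  shows "Term j \<notin> tie_set n A \<rho>"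
proof
  assume "Term j \<in> tie_set n A \<rho>"
  then have "\<Phi> n A \<rho> (Term j) \<le> \<Phi> n A \<rho> (Term i)"
    using ij(1) unfolding in_tie_set_iff by (auto simp: tie_indices_def)
  moreover have "\<Phi> n A r (Term i) \<le> \<Phi> n A r (Term j)"
    using T ij(2) unfolding in_tie_set_iff by (auto simp: tie_indices_def)
  moreover have "0 < (int (n i) - int (n j)) * (int r - int \<rho>)" using less by simp
  ultimately show False by (simp add: algebra_simps)
qed

lemma Deriv_not_tied_below:
  assumes T: "Term i \<in> tie_set n A r" and i: "i \<in> {1, 2, 3}" and less: "\<rho> < r"
  shows "Deriv \<notin> tie_set n A \<rho>"
proof
  assume "Deriv \<in> tie_set n A \<rho>"
  then have "\<Phi> n A \<rho> Deriv \<le> \<Phi> n A \<rho> (Term i)"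
    using i unfolding in_tie_set_iff by (auto simp: tie_indices_def)
  moreover have "\<Phi> n A r (Term i) \<le> \<Phi> n A r Deriv"
    using T unfolding in_tie_set_iff by (auto simp: tie_indices_def)
  moreover have "1 < n i" using i n by auto
  then have "0 < (int (n i) - 1) * (int r - int \<rho>)" using less by simp
  ultimately show False by (simp add: algebra_simps)
qed

text \<open>The order of \<open>Term 3\<close> has the largest slope, so below \<open>r\<close> it
  alone is minimal, whereas a realized degree carries at least two ties.\<close>

lemma no_tie_below_Term3:
  assumes "Term 3 \<in> tie_set n A r" "\<rho> \<in> Gamma_sol n A"
  shows "r \<le> \<rho>"
proof (rule ccontr)
  assume "\<not> r \<le> \<rho>"
  then have less: "\<rho> < r" by simp
  have "Term 2 \<notin> tie_set n A \<rho>" "Term 1 \<notin> tie_set n A \<rho>" "Deriv \<notin> tie_set n A \<rho>"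
    using n less_trans[OF n(2,3)]
    by (intro Term_not_tied_below[OF assms(1) _ _ less] Deriv_not_tied_below[OF assms(1) _ less],
      simp_all)+
  then have "tie_set n A \<rho> \<subseteq> {Term 3}" using tie_set_subset[of \<rho>] by blast
  then have "card (tie_set n A \<rho>) \<le> 1" using card_mono[of "{Term 3}"] by simp
  with Gamma_sol_facts(3)[OF assms(2)] show False by simp
qed

lemma tie_set_below_Term2:
  assumes "Term 2 \<in> tie_set n A r" "\<rho> \<in> Gamma_sol n A" "\<rho> < r"
  shows "tie_set n A \<rho> = {Term 3, Term 2}"
proof -
  have "Term 1 \<notin> tie_set n A \<rho>" "Deriv \<notin> tie_set n A \<rho>"
    using n by (intro Term_not_tied_below[OF assms(1) _ _ assms(3)]
      Deriv_not_tied_below[OF assms(1) _ assms(3)], simp_all)+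
  then have "tie_set n A \<rho> \<subseteq> {Term 3, Term 2}" using tie_set_subset[of \<rho>] by blast
  moreover have "card {Term 3, Term 2} \<le> card (tie_set n A \<rho>)"
    using Gamma_sol_facts(3)[OF assms(2)] by simp
  ultimately show ?thesis by (intro card_seteq) auto
qed

section \<open>Root counts by tie set\<close>

lemma card_nz_roots_two_ties:
  assumes "tie_set n A \<rho> = {Term 3, Term 2} \<or> tie_set n A \<rho> = {Term 2, Term 1}"
  shows "card (nz_roots (edge_poly n A \<rho>)) \<le> 2"
  using assms
proof
  assume T: "tie_set n A \<rho> = {Term 3, Term 2}"
  have "edge_poly n A \<rho> = monom (lead_coeff (A 2)) (n 2) + monom (lead_coeff (A 3)) (n 3)"
    by (simp add: edge_poly_eq edge_coeff_def edge_dcoeff_def T)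
  then show ?thesis
    using card_nz_roots_binomial[OF n(3), of "lead_coeff (A 2)" "lead_coeff (A 3)"] A_nz
      gap_weight_le[of "n 3 - n 2"] by simp
next
  assume T: "tie_set n A \<rho> = {Term 2, Term 1}"
  have "edge_poly n A \<rho> = monom (lead_coeff (A 1)) (n 1) + monom (lead_coeff (A 2)) (n 2)"
    by (simp add: edge_poly_eq edge_coeff_def edge_dcoeff_def T)
  then show ?thesis
    using card_nz_roots_binomial[OF n(2), of "lead_coeff (A 1)" "lead_coeff (A 2)"] A_nz
      gap_weight_le[of "n 2 - n 1"] by simp
qed

lemma card_nz_roots_three_ties:
  assumes \<rho>: "\<rho> \<ge> 1" and T: "card (tie_set n A \<rho>) = 3"
  shows "card (nz_roots (edge_poly n A \<rho>)) \<le> 4"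
proof -
  have bound: "card (nz_roots (monom a i + monom b j + monom c k)) \<le> 4"
    if "i < j" "j < k" "a \<noteq> 0" "b \<noteq> 0" "c \<noteq> 0" for a b c :: real and i j k
    using card_nz_roots_trinomial[OF that] gap_weight_le[of "j - i"] gap_weight_le[of "k - j"]
    by linarith
  \<comment> \<open>The tie set is described by the one index \<open>l\<close> that it omits; each
    choice leaves a trinomial with two gaps of weight at most 2.\<close>
  obtain l where l: "l \<in> {Term 3, Term 2, Term 1, Deriv}"
    "tie_set n A \<rho> = {Term 3, Term 2, Term 1, Deriv} - {l}"
  proof -
    have "card ({Term 3, Term 2, Term 1, Deriv} - tie_set n A \<rho>) = 1"
      using T card_Diff_subset[OF finite_tie_set tie_set_subset, of \<rho>] by simp
    then obtain l where "{Term 3, Term 2, Term 1, Deriv} - tie_set n A \<rho> = {l}"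
      by (auto simp: card_1_singleton_iff)
    then show ?thesis using that[of l] tie_set_subset[of \<rho>] by blast
  qed
  define a where "a i = lead_coeff (A i)" for i
  have a: "a 1 \<noteq> 0" "a 2 \<noteq> 0" "a 3 \<noteq> 0" "real \<rho> \<noteq> 0" using A_nz \<rho> by (auto simp: a_def)
  have P: "edge_poly n A \<rho> = (if l = Deriv then 0 else monom (real \<rho>) 1)
    + (if l = Term 1 then 0 else monom (a 1) (n 1))
    + (if l = Term 2 then 0 else monom (a 2) (n 2))
    + (if l = Term 3 then 0 else monom (a 3) (n 3))"
    by (simp add: edge_poly_eq edge_coeff_def edge_dcoeff_def l(2) a_def)
  from l(1) consider "l = Term 3" | "l = Term 2" | "l = Term 1" | "l = Deriv" by blast
  then show ?thesis
  proof cases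
    case 1
    have "edge_poly n A \<rho> = monom (real \<rho>) 1 + monom (a 1) (n 1) + monom (a 2) (n 2)"
      unfolding P using 1 by simp
    then show ?thesis using bound[OF n(1,2) a(4,1,2)] by (simp only:)
  next
    case 2
    have "edge_poly n A \<rho> = monom (real \<rho>) 1 + monom (a 1) (n 1) + monom (a 3) (n 3)"
      unfolding P using 2 by simp
    then show ?thesis using bound[OF n(1) less_trans[OF n(2,3)] a(4,1,3)] by (simp only:)
  next
    case 3
    have "edge_poly n A \<rho> = monom (real \<rho>) 1 + monom (a 2) (n 2) + monom (a 3) (n 3)"
      unfolding P using 3 by simp
    then show ?thesis using bound[OF less_trans[OF n(1,2)] n(3) a(4,2,3)] by (simp only:)
  next
    case 4
    have "edge_poly n A \<rho> = monom (a 1) (n 1) + monom (a 2) (n 2) + monom (a 3) (n 3)"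
      unfolding P using 4 by simp
    then show ?thesis using bound[OF n(2,3) a(1,2,3)] by (simp only:)
  qed
qed

text \<open>The Rolle bound reaches 6 only if all three gaps are even. Then all exponents are odd,
  the edge polynomial is an odd function and its roots come in opposite pairs, against
  (ND3,b).\<close>

lemma card_nz_roots_four_ties:
  assumes r: "r \<in> Gamma_sol n A" and T: "tie_set n A r = {Term 3, Term 2, Term 1, Deriv}"
  shows "card (nz_roots (edge_poly n A r)) \<le> 5"
proof -
  note facts = Gamma_sol_facts[OF r]
  define a where "a i = lead_coeff (A i)" for i
  have a: "a 1 \<noteq> 0" "a 2 \<noteq> 0" "a 3 \<noteq> 0" "real r \<noteq> 0" using A_nz facts(1) by (auto simp: a_def)
  have P: "edge_poly n A r
    = monom (real r) 1 + monom (a 1) (n 1) + monom (a 2) (n 2) + monom (a 3) (n 3)"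
    by (simp add: edge_poly_eq edge_coeff_def edge_dcoeff_def T a_def)
  have le: "card (nz_roots (edge_poly n A r))
    \<le> gap_weight (n 1 - 1) + gap_weight (n 2 - n 1) + gap_weight (n 3 - n 2)"
    unfolding P using card_nz_roots_quadrinomial[OF n a(4,1,2,3)] .
  have "odd (n 1 - 1) \<or> odd (n 2 - n 1) \<or> odd (n 3 - n 2)"
  proof (rule ccontr)
    assume "\<not> ?thesis"
    then have odd: "odd (n 1)" "odd (n 2)" "odd (n 3)" and even: "even (n 3 - 1)" using n by auto
    obtain c where c: "c \<noteq> 0" "poly (edge_poly n A r) c = 0"
      using facts(2) by (auto simp: nz_roots_def)
    have "poly (edge_poly n A r) (- c) = - poly (edge_poly n A r) c"
      using odd by (simp add: P poly_monom)
    with ND3b_no_opposite_roots[OF facts(6) even facts(1) c] c(2) show False by simp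
  qed
  then have "gap_weight (n 1 - 1) + gap_weight (n 2 - n 1) + gap_weight (n 3 - n 2) \<le> 5"
    by (auto simp: gap_weight_def)
  with le show ?thesis by simp
qed

lemma card_sols_single_degree:
  assumes "Term 3 \<in> tie_set n A r" "r \<in> Gamma_sol n A" "\<forall>\<rho>\<in>Gamma_sol n A. \<rho> \<le> r"
  shows "card sols \<le> card (nz_roots (edge_poly n A r))"
proof -
  have "Gamma_sol n A = {r}"
    using no_tie_below_Term3[OF assms(1)] assms(2,3) by (auto intro: antisym)
  then show ?thesis using card_sols_le by simp
qed

text \<open>Every other realized degree has the tie set \<open>{Term 3, Term 2}\<close> and hence
  equals \<open>r_32\<close>. There is at most one such degree, and it adds at most two
  roots.\<close>

lemma card_sols_two_degrees:
  assumes T: "Term 2 \<in> tie_set n A r" and r: "r \<in> Gamma_sol n A" "\<forall>\<rho>\<in>Gamma_sol n A. \<rho> \<le> r"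
  shows "card sols \<le> card (nz_roots (edge_poly n A r)) + 2"
proof -
  let ?f = "\<lambda>\<rho>. card (nz_roots (edge_poly n A \<rho>))"
  have below: "tie_set n A \<rho> = {Term 3, Term 2}" if "\<rho> \<in> Gamma_sol n A - {r}" for \<rho>
    using tie_set_below_Term2[OF T] r(2) that by (metis DiffE insertI1 le_neq_implies_less)
  have cand: "real \<rho> = cand_pair n A 3 2" if "\<rho> \<in> Gamma_sol n A - {r}" for \<rho>
  proof (rule cand_pair_eq)
    have "Term 3 \<in> tie_set n A \<rho>" "Term 2 \<in> tie_set n A \<rho>" using below[OF that] by auto
    then show "\<Phi> n A \<rho> (Term 3) = \<Phi> n A \<rho> (Term 2)" unfolding tie_set_def by simp
  qed (rule n)
  have "card (Gamma_sol n A - {r}) \<le> 1"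
    using finite_Gamma_sol cand by (auto simp: card_le_Suc0_iff_eq) (metis of_nat_eq_iff)
  moreover have "sum ?f (Gamma_sol n A - {r}) \<le> of_nat (card (Gamma_sol n A - {r})) * 2"
    using below card_nz_roots_two_ties by (intro sum_bounded_above) blast
  ultimately have "sum ?f (Gamma_sol n A - {r}) \<le> 2" by simp
  moreover have "sum ?f (Gamma_sol n A) = ?f r + sum ?f (Gamma_sol n A - {r})"
    using finite_Gamma_sol r(1) by (rule sum.remove)
  ultimately show ?thesis using card_sols_le by linarith
qed

end

text \<open>The finiteness and nonemptiness claims ensure that \<open>card\<close> and
  \<open>Max\<close> are not default values.\<close>

theorem corollary6p4:
  fixes n :: "nat \<Rightarrow> nat" and A :: "nat \<Rightarrow> real poly" and r :: nat
  assumes "1 < n 1" and "n 1 < n 2" and "n 2 < n 3"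
    and "A 1 \<noteq> 0" and "A 2 \<noteq> 0" and "A 3 \<noteq> 0"
    and "ND n A"
    and "\<exists>x \<in> nonconst_rat_sols n A. \<exists>y \<in> nonconst_rat_sols n A. x \<noteq> y"
    and "r = Max (Gamma_sol n A)"
  shows "finite (nonconst_rat_sols n A) \<and> finite (Gamma_sol n A) \<and> Gamma_sol n A \<noteq> {} \<and>
    (C1 n A r \<longrightarrow>
       tie_set n A r = {Term 3, Term 2, Deriv} \<and> card (nonconst_rat_sols n A) \<le> 4) \<and>
    (C2 n A r \<and> tie_set n A r = {Term 2, Term 1} \<longrightarrow> card (nonconst_rat_sols n A) \<le> 5) \<and>
    (C2 n A r \<and> tie_set n A r = {Term 3, Term 2, Term 1} \<longrightarrow> card (nonconst_rat_sols n A) \<le> 4) \<and>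
    (C3 n A r \<and> tie_set n A r = {Term 2, Term 1, Deriv} \<longrightarrow> card (nonconst_rat_sols n A) \<le> 12) \<and>
    (C3 n A r \<and> tie_set n A r = {Term 3, Term 1, Deriv} \<longrightarrow> card (nonconst_rat_sols n A) \<le> 4) \<and>
    (C3 n A r \<and> tie_set n A r = {Term 3, Term 2, Term 1, Deriv} \<longrightarrow>
       card (nonconst_rat_sols n A) \<le> 5)"
proof -
  interpret three_term_ND n A by unfold_locales (fact assms)+
  obtain x p where x: "x \<in> sols" "x = Fract 1 p" "degree p \<ge> 1"
    using assms(8) sol_cases by metis
  then have nonempty: "Gamma_sol n A \<noteq> {}" by (auto simp: Gamma_sol_def)
  have r: "r \<in> Gamma_sol n A" "\<forall>\<rho>\<in>Gamma_sol n A. \<rho> \<le> r"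
    using finite_Gamma_sol nonempty assms(9) by auto
  note r1 = Gamma_sol_facts(1)[OF r(1)]
  have C1: "tie_set n A r = {Term 3, Term 2, Deriv}" if C1: "C1 n A r"
  proof -
    \<comment> \<open>(C1) in terms of orders: \<open>Term 1\<close> is never minimal, and
      \<open>Term 2\<close> and \<open>Deriv\<close> are tied together or not at all.\<close>
    have lt: "\<Phi> n A r Deriv < \<Phi> n A r (Term 1)" and eq: "\<Phi> n A r (Term 2) = \<Phi> n A r Deriv"
      using C1 by (auto simp: C1_def algebra_simps)
    have "Term 1 \<notin> tie_set n A r" using lt
      by (auto simp: in_tie_set_iff tie_indices_def simp del: \<Phi>.simps)
    moreover have iff: "Term 2 \<in> tie_set n A r \<longleftrightarrow> Deriv \<in> tie_set n A r"
      using eq by (auto simp: in_tie_set_iff tie_indices_def simp del: \<Phi>.simps)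
    ultimately consider "tie_set n A r \<subseteq> {Term 3}" | "tie_set n A r = {Term 2, Deriv}"
      | "tie_set n A r = {Term 3, Term 2, Deriv}"
      using tie_set_subset[of r] by blast
    then show ?thesis
    proof cases
      case 1
      then have "card (tie_set n A r) \<le> 1" using card_mono[of "{Term 3}"] by simp
      then show ?thesis using Gamma_sol_facts(3)[OF r(1)] by simp
    next
      case 2
      then show ?thesis using tie_set_ne_Term_Deriv[OF r(1), of 2] by simp
    qed
  qed
  have three: "card sols \<le> 4" if "tie_set n A r \<in> {{Term 3, Term 2, Deriv},
      {Term 3, Term 2, Term 1}, {Term 3, Term 1, Deriv}}"
  proof -
    have "Term 3 \<in> tie_set n A r" "card (tie_set n A r) = 3"
      using that by (elim insertE emptyE; simp)+
    from card_sols_single_degree[OF this(1) r] card_nz_roots_three_ties[OF r1 this(2)]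
    show ?thesis by (rule le_trans)
  qed
  have four: "card sols \<le> 5" if T: "tie_set n A r = {Term 3, Term 2, Term 1, Deriv}"
  proof -
    have "Term 3 \<in> tie_set n A r" using T by simp
    from card_sols_single_degree[OF this r] card_nz_roots_four_ties[OF r(1) T]
    show ?thesis by (rule le_trans)
  qed
  have two: "card sols \<le> 5" if T: "tie_set n A r = {Term 2, Term 1}"
  proof -
    \<comment> \<open>Two roots at \<open>r\<close> and at most two at the lower degree give
      4.\<close>
    have "Term 2 \<in> tie_set n A r" using T by simp
    from card_sols_two_degrees[OF this r] card_nz_roots_two_ties[of r] T show ?thesis by simp
  qed
  have low: "card sols \<le> 12" if T: "tie_set n A r = {Term 2, Term 1, Deriv}"
  proof -
    \<comment> \<open>Four roots at \<open>r\<close> and at most two at the lower degree give 6,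
      within the claimed 12.\<close>
    have "Term 2 \<in> tie_set n A r" "card (tie_set n A r) = 3" using T by simp_all
    from card_sols_two_degrees[OF this(1) r] card_nz_roots_three_ties[OF r1 this(2)]
    show ?thesis by linarith
  qed
  show ?thesis
    using card_sols_le finite_Gamma_sol nonempty C1 three four two low by blast
qed

end
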